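(* Let $1\le r\le s\le t$ and $n=r+s+t+1$. Then $$n+3=r+s+t+4\le D^{f}_{2r+1}(E3C(r,s,t))\le D_{2r+2}(E3C(r,s,t))\le r+s+t+6=n+5.$$
   Context: The exchanged 3-ary $n$-cube $E3C(r,s,t)$ ($r,s,t\ge1$, $n=r+s+t+1$): vertices are strings written $x=ABCd$ with $A\in\{0,1,2\}^r$, $B\in\{0,1,2\}^s$, $C\in\{0,1,2\}^t$, $d\in\{0,1,2\}$. Two distinct vertices $x=ABCd$, $y=A'B'C'd'$ are adjacent iff one of: (E0) $A=A',B=B',C=C'$ and $d\ne d'$; (E1) $d=d'=0$, $A=A'$, $B=B'$ and $C,C'$ differ in exactly one position; (E2) $d=d'=1$, $A=A'$, $C=C'$ and $B,B'$ differ in exactly one position; (E3) $d=d'=2$, $B=B'$, $C=C'$ and $A,A'$ differ in exactly one position. For a connected graph $G$ with vertex connectivity $\kappa(G)$: the $\alpha$-fault diameter ($1\le\alpha\le\kappa(G)-1$) is $D^f_\alpha(G)=\max\{d_{G-F}(u,v): u\ne v,\ F\subseteq V(G)\setminus\{u,v\},\ |F|=\alpha\}$; the $\beta$-wide diameter ($1\le\beta\le\kappa(G)$) $D_\beta(G)$ is the maximum over distinct $u,v$ of the minimum, over all families of $\beta$ pairwise internally disjoint $u$–$v$ paths, of the maximum length of a path in the family. (It is known that $\kappa(E3C(r,s,t))=2r+2$ when $r\le s\le t$.) *)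

theory Defs
  imports Main "HOL-Library.Extended_Nat"
begin

definition gpath :: "'a set \<Rightarrow> ('a \<Rightarrow> 'a \<Rightarrow> bool) \<Rightarrow> 'a list \<Rightarrow> 'a \<Rightarrow> 'a \<Rightarrow> bool" where
  "gpath V E p u v \<longleftrightarrow> p \<noteq> [] \<and> hd p = u \<and> last p = v \<and> distinct p \<and> set p \<subseteq> V \<and>
      (\<forall>i. i + 1 < length p \<longrightarrow> E (p ! i) (p ! (i + 1)))"

definition plen :: "'a list \<Rightarrow> nat" where
  "plen p = length p - 1"

text \<open>Distance in the subgraph induced by V (infinite if no path).\<close>
definition gdist :: "'a set \<Rightarrow> ('a \<Rightarrow> 'a \<Rightarrow> bool) \<Rightarrow> 'a \<Rightarrow> 'a \<Rightarrow> enat" where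
  "gdist V E u v = Inf {enat (plen p) | p. gpath V E p u v}"

definition fault_diam :: "'a set \<Rightarrow> ('a \<Rightarrow> 'a \<Rightarrow> bool) \<Rightarrow> nat \<Rightarrow> enat" where
  "fault_diam V E \<alpha> = Sup {gdist (V - F) E u v | u v F.
      u \<in> V \<and> v \<in> V \<and> u \<noteq> v \<and> F \<subseteq> V - {u, v} \<and> finite F \<and> card F = \<alpha>}"

definition disj_paths :: "'a set \<Rightarrow> ('a \<Rightarrow> 'a \<Rightarrow> bool) \<Rightarrow> nat \<Rightarrow> 'a \<Rightarrow> 'a \<Rightarrow> 'a list set \<Rightarrow> bool" where
  "disj_paths V E \<beta> u v P \<longleftrightarrow> finite P \<and> card P = \<beta> \<and> (\<forall>p\<in>P. gpath V E p u v) \<and>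
      (\<forall>p\<in>P. \<forall>q\<in>P. p \<noteq> q \<longrightarrow> set p \<inter> set q \<subseteq> {u, v})"

definition wide_diam :: "'a set \<Rightarrow> ('a \<Rightarrow> 'a \<Rightarrow> bool) \<Rightarrow> nat \<Rightarrow> enat" where
  "wide_diam V E \<beta> = Sup {Inf {Sup ((\<lambda>p. enat (plen p)) ` P) | P. disj_paths V E \<beta> u v P} | u v.
      u \<in> V \<and> v \<in> V \<and> u \<noteq> v}"

definition tern_words :: "nat \<Rightarrow> nat list set" where
  "tern_words k = {xs. length xs = k \<and> set xs \<subseteq> {0, 1, 2}}"

text \<open>Vertex ABCd is represented as the tuple (A, B, C, d).\<close>
type_synonym e3c_vertex = "nat list \<times> nat list \<times> nat list \<times> nat"

definition E3C_V :: "nat \<Rightarrow> nat \<Rightarrow> nat \<Rightarrow> e3c_vertex set" where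
  "E3C_V r s t = {(A, B, C, d). A \<in> tern_words r \<and> B \<in> tern_words s \<and> C \<in> tern_words t \<and> d \<in> {0, 1, 2}}"

definition differ_one :: "nat list \<Rightarrow> nat list \<Rightarrow> bool" where
  "differ_one X Y \<longleftrightarrow> length X = length Y \<and> card {i. i < length X \<and> X ! i \<noteq> Y ! i} = 1"

definition E3C_E :: "e3c_vertex \<Rightarrow> e3c_vertex \<Rightarrow> bool" where
  "E3C_E x y \<longleftrightarrow> (case (x, y) of ((A, B, C, d), (A', B', C', d')) \<Rightarrow>
      x \<noteq> y \<and>
      ((A = A' \<and> B = B' \<and> C = C' \<and> d \<noteq> d') \<or>
       (d = 0 \<and> d' = 0 \<and> A = A' \<and> B = B' \<and> differ_one C C') \<or>
       (d = 1 \<and> d' = 1 \<and> A = A' \<and> C = C' \<and> differ_one B B') \<or>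
       (d = 2 \<and> d' = 2 \<and> B = B' \<and> C = C' \<and> differ_one A A')))"

end

theory Submission
  imports Defs "HOL-Library.Disjoint_Sets" "HOL-Combinatorics.Transposition"
begin

text \<open>
  Lower bound: let \<open>u\<close> and \<open>v\<close> lie in layer 2 and differ in every position, and delete all neighbours
  of \<open>u\<close> except one, \<open>w\<close>, that also differs from \<open>v\<close> in every position. Every path from \<open>w\<close> to \<open>v\<close>
  corrects \<open>r + s + t\<close> positions and changes the layer three times.

  Middle inequality: \<open>2r + 1\<close> faults meet at most \<open>2r + 1\<close> of \<open>2r + 2\<close> internally disjoint paths.

  Upper bound: up to permuting the three words and reversing paths, \<open>u = (X, Y, Z, 2)\<close> and
  \<open>v = (X', Y', Z', d)\<close> with \<open>d\<close> 2 or 1. It suffices to confine walks to pairwise disjoint vertex sets.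
  For \<open>d = 2\<close> a walk starts at each neighbour \<open>P\<close> of \<open>X\<close>, carries \<open>P\<close> along while it corrects \<open>Y\<close> and
  then \<open>Z\<close>, and finishes in a fan from the neighbours of \<open>X\<close> to \<open>X'\<close> in the ternary Hamming graph.
  For \<open>d = 1\<close> neighbours \<open>P\<close> of \<open>X\<close> are matched with neighbours \<open>Q\<close> of \<open>Y'\<close>; a walk corrects \<open>Y\<close> to
  \<open>Q\<close> beside \<open>P\<close>, then \<open>Z\<close>, and then \<open>P\<close> to \<open>X'\<close> beside \<open>Q\<close>. The remaining one or two walks make
  a detour through a third word, different from both end values.
\<close>

section \<open>Walks inside a vertex set\<close>

inductive walk_le :: "('a \<Rightarrow> 'a \<Rightarrow> bool) \<Rightarrow> 'a set \<Rightarrow> nat \<Rightarrow> 'a \<Rightarrow> 'a \<Rightarrow> bool" for E S where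
  refl: "a \<in> S \<Longrightarrow> walk_le E S k a a"
| step: "a \<in> S \<Longrightarrow> E a b \<Longrightarrow> walk_le E S k b c \<Longrightarrow> walk_le E S (Suc k) a c"

lemma walk_le_mono:
  assumes "walk_le E S k a b" "S \<subseteq> T" "k \<le> l"
  shows "walk_le E T l a b"
  using assms
proof (induction arbitrary: l)
  case (refl a k)
  then show ?case by (auto intro: walk_le.refl)
next
  case (step a b k c)
  then obtain l' where "l = Suc l'" "k \<le> l'" by (cases l) auto
  with step show ?case by (auto intro: walk_le.step)
qed

lemma walk_le_trans [trans]:
  assumes "walk_le E S k a b" "walk_le E S l b c"
  shows "walk_le E S (k + l) a c"
  using assms
proof induction
  case (refl a k)
  then show ?case by (auto intro: walk_le_mono)
next
  case (step a b k c)
  then show ?case by (auto intro: walk_le.step)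
qed

lemma walk_le_edge: "a \<in> S \<Longrightarrow> b \<in> S \<Longrightarrow> E a b \<Longrightarrow> walk_le E S 1 a b"
  by (auto intro: walk_le.intros)

lemma walk_le_map:
  assumes "walk_le E S k a b" and "\<And>x y. E x y \<Longrightarrow> E' (f x) (f y)" and "f ` S \<subseteq> T"
  shows "walk_le E' T k (f a) (f b)"
  using assms
proof induction
  case (refl a k)
  then show ?case by (auto intro!: walk_le.refl)
next
  case (step a b k c)
  then show ?case by (intro walk_le.step[of "f a" _ _ "f b"]) auto
qed

lemma walk_le_chain:
  assumes "a \<le> b" and "\<And>l. a \<le> l \<Longrightarrow> l \<le> b \<Longrightarrow> w l \<in> S"
    and "\<And>l. a \<le> l \<Longrightarrow> l < b \<Longrightarrow> w (Suc l) = w l \<or> E (w l) (w (Suc l))"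
  shows "walk_le E S (b - a) (w a) (w b)"
  using assms
proof (induction b rule: dec_induct)
  case base
  then show ?case by (simp add: walk_le.refl)
next
  case (step b)
  have "walk_le E S (b - a) (w a) (w b)"
    using step by simp
  also have "walk_le E S 1 (w b) (w (Suc b))"
  proof (cases "w (Suc b) = w b")
    case True
    then show ?thesis using step by (simp add: walk_le.refl)
  next
    case False
    then show ?thesis using step by (intro walk_le_edge) auto
  qed
  finally show ?case
    using step(1) by (simp add: Suc_diff_le)
qed

lemma gpath_Cons:
  assumes "gpath V E p b v" "E a b" "a \<notin> set p" "a \<in> V"
  shows "gpath V E (a # p) a v"
  using assms unfolding gpath_def
  by (auto simp: nth_Cons hd_conv_nth split: nat.split)

lemma gpath_drop:
  assumes "gpath V E p u v" "i < length p"
  shows "gpath V E (drop i p) (p ! i) v"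
  using assms set_drop_subset[of i p] unfolding gpath_def
  by (auto simp: hd_drop_conv_nth)

lemma gpath_mono: "gpath V E p u v \<Longrightarrow> V \<subseteq> W \<Longrightarrow> gpath W E p u v"
  unfolding gpath_def by auto

lemma gpath_set_subset: "gpath V E p u v \<Longrightarrow> set p \<subseteq> V"
  by (simp add: gpath_def)

lemma walk_le_imp_gpath:
  assumes "walk_le E S k a b"
  shows "\<exists>p. gpath S E p a b \<and> plen p \<le> k"
  using assms
proof induction
  case (refl a k)
  then have "gpath S E [a] a a" by (auto simp: gpath_def)
  then show ?case by (force simp: plen_def)
next
  case (step a b k c)
  then obtain p where p: "gpath S E p b c" "plen p \<le> k" by auto
  show ?case
  proof (cases "a \<in> set p")
    case True
    then obtain i where i: "i < length p" "p ! i = a" by (auto simp: in_set_conv_nth)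
    have "plen (drop i p) \<le> Suc k" using p(2) by (auto simp: plen_def)
    then show ?thesis using gpath_drop[OF p(1) i(1)] i(2) by auto
  next
    case False
    have "plen (a # p) \<le> Suc k" using p by (auto simp: plen_def)
    then show ?thesis using gpath_Cons[OF p(1) \<open>E a b\<close> False \<open>a \<in> S\<close>] by auto
  qed
qed

section \<open>Families of internally disjoint paths\<close>

definition linkable :: "'a set \<Rightarrow> ('a \<Rightarrow> 'a \<Rightarrow> bool) \<Rightarrow> nat \<Rightarrow> nat \<Rightarrow> 'a \<Rightarrow> 'a \<Rightarrow> bool" where
  "linkable V E n k u v \<longleftrightarrow> (\<exists>P. disj_paths V E n u v P \<and> (\<forall>p\<in>P. plen p \<le> k))"

lemma linkable_mono:
  assumes "linkable V E n k u v" "n' \<le> n"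
  shows "linkable V E n' k u v"
proof -
  obtain P where P: "disj_paths V E n u v P" "\<forall>p\<in>P. plen p \<le> k"
    using assms by (auto simp: linkable_def)
  then obtain Q where "Q \<subseteq> P" "card Q = n'" "finite Q"
    using assms(2) obtain_subset_with_card_n[of n' P] by (auto simp: disj_paths_def)
  then have "disj_paths V E n' u v Q"
    using P(1) unfolding disj_paths_def by (meson subsetD)
  then show ?thesis using P(2) \<open>Q \<subseteq> P\<close> by (auto simp: linkable_def)
qed

lemma gpath_map:
  assumes p: "gpath V E p u v" and inj: "inj_on f V" and V: "f ` V \<subseteq> W"
    and E: "\<And>x y. x \<in> V \<Longrightarrow> y \<in> V \<Longrightarrow> E x y \<Longrightarrow> E' (f x) (f y)"
  shows "gpath W E' (map f p) (f u) (f v)"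
proof -
  note p_sub = gpath_set_subset[OF p]
  then have "distinct (map f p)"
    using p inj by (auto simp: gpath_def distinct_map intro: inj_on_subset)
  moreover have "E' (map f p ! i) (map f p ! (i + 1))" if "i + 1 < length (map f p)" for i
  proof -
    have "p ! i \<in> V" "p ! (i + 1) \<in> V" "E (p ! i) (p ! (i + 1))"
      using that p p_sub by (auto simp: gpath_def)
    then show ?thesis using that E by auto
  qed
  ultimately show ?thesis
    using p V p_sub by (auto simp: gpath_def hd_map last_map)
qed

lemma linkable_map:
  assumes "linkable V E n k u v" and inj: "inj_on f V" and fV: "f ` V \<subseteq> W"
    and E: "\<And>x y. x \<in> V \<Longrightarrow> y \<in> V \<Longrightarrow> E x y \<Longrightarrow> E' (f x) (f y)"
  shows "linkable W E' n k (f u) (f v)"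
proof -
  obtain P where P: "disj_paths V E n u v P" "\<forall>p\<in>P. plen p \<le> k"
    using assms(1) by (auto simp: linkable_def)
  have PV: "set p \<subseteq> V" if "p \<in> P" for p
    using P(1) that by (auto simp: disj_paths_def gpath_def)
  have "inj_on (map f) P"
    by (rule inj_on_mapI, rule inj_on_subset[OF inj]) (use PV in auto)
  then have "card (map f ` P) = n" using P(1) by (auto simp: card_image disj_paths_def)
  moreover have "set (map f p) \<inter> set (map f q) \<subseteq> {f u, f v}"
    if "p \<in> P" "q \<in> P" "map f p \<noteq> map f q" for p q
  proof -
    have "p \<noteq> q" using that by auto
    then have "set p \<inter> set q \<subseteq> {u, v}" using P(1) that unfolding disj_paths_def by blast
    moreover have "f ` set p \<inter> f ` set q = f ` (set p \<inter> set q)"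
      using inj_on_image_Int[OF inj PV[OF that(1)] PV[OF that(2)]] by simp
    ultimately show ?thesis by auto
  qed
  moreover have "gpath W E' (map f p) (f u) (f v)" if "p \<in> P" for p
    by (rule gpath_map[where E = E, OF _ inj fV]) (use P(1) that E in \<open>auto simp: disj_paths_def\<close>)
  ultimately have "disj_paths W E' n (f u) (f v) (map f ` P)"
    using P(1) unfolding disj_paths_def by (simp add: ball_simps)
  moreover have "\<forall>p\<in>map f ` P. plen p \<le> k" using P(2) by (auto simp: plen_def)
  ultimately show ?thesis by (auto simp: linkable_def)
qed

lemma gpath_rev:
  assumes p: "gpath V E p u v" and sym: "\<And>x y. E x y \<Longrightarrow> E y x"
  shows "gpath V E (rev p) v u"
proof -
  have "E (rev p ! i) (rev p ! (i + 1))" if "i + 1 < length (rev p)" for i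
  proof -
    define j where "j = length p - Suc (Suc i)"
    have "E (p ! j) (p ! (j + 1))" using p that by (auto simp: gpath_def j_def)
    moreover have "rev p ! i = p ! (j + 1)" "rev p ! (i + 1) = p ! j"
      using that by (auto simp: rev_nth j_def Suc_diff_Suc)
    ultimately show ?thesis using sym by auto
  qed
  then show ?thesis using p by (auto simp: gpath_def hd_rev last_rev)
qed

lemma linkable_rev:
  assumes "linkable V E n k u v" and sym: "\<And>x y. E x y \<Longrightarrow> E y x"
  shows "linkable V E n k v u"
proof -
  obtain P where P: "disj_paths V E n u v P" "\<forall>p\<in>P. plen p \<le> k"
    using assms(1) by (auto simp: linkable_def)
  have "card (rev ` P) = n" using P(1) by (auto simp: disj_paths_def card_image)
  moreover have "gpath V E (rev p) v u" if "p \<in> P" for p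
    using gpath_rev[where E = E] sym P(1) that by (auto simp: disj_paths_def)
  moreover have "set p \<inter> set q \<subseteq> {v, u}" if "p \<in> P" "q \<in> P" "p \<noteq> q" for p q
    using P(1) that unfolding disj_paths_def by blast
  ultimately have "disj_paths V E n v u (rev ` P)"
    using P(1) unfolding disj_paths_def by auto
  moreover have "\<forall>p\<in>rev ` P. plen p \<le> k" using P(2) by (auto simp: plen_def)
  ultimately show ?thesis by (auto simp: linkable_def)
qed

definition route :: "('a \<Rightarrow> 'a \<Rightarrow> bool) \<Rightarrow> 'a set \<Rightarrow> 'a \<Rightarrow> 'a \<Rightarrow> nat \<Rightarrow> 'a set \<Rightarrow> bool" where
  "route E V u v k S \<longleftrightarrow> S \<subseteq> V - {u, v} \<and> (\<exists>a\<in>S. E u a \<and> walk_le E (insert v S) k a v)"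

lemma route_subset: "route E V u v k S \<Longrightarrow> S \<subseteq> V - {u, v}"
  by (simp add: route_def)

lemma route_nonempty: "route E V u v k S \<Longrightarrow> S \<noteq> {}"
  by (auto simp: route_def)

lemma route_mono: "route E V u v k S \<Longrightarrow> k \<le> l \<Longrightarrow> route E V u v l S"
  unfolding route_def by (meson order_refl walk_le_mono)

lemma route_map:
  assumes "route E V u v k S" and "inj f" and "f ` V \<subseteq> W"
    and E: "\<And>x y. E x y \<Longrightarrow> E' (f x) (f y)"
  shows "route E' W (f u) (f v) k (f ` S)"
proof -
  obtain a where "a \<in> S" "E u a" and walk: "walk_le E (insert v S) k a v" and S: "S \<subseteq> V - {u, v}"
    using assms(1) by (auto simp: route_def)
  have "walk_le E' (insert (f v) (f ` S)) k (f a) (f v)"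
    by (rule walk_le_map[where E = E and f = f, OF walk]) (auto intro: E)
  moreover have "f ` S \<subseteq> W - {f u, f v}"
    using S assms(2,3) by (auto dest: injD)
  ultimately show ?thesis
    using \<open>a \<in> S\<close> \<open>E u a\<close> E unfolding route_def by blast
qed

lemma route_snoc:
  assumes R: "route E V u w k S" and "E w v" "w \<in> V" "w \<noteq> u" "w \<noteq> v" "v \<notin> S"
  shows "route E V u v (Suc k) (insert w S)"
proof -
  obtain a where a: "a \<in> S" "E u a" and walk: "walk_le E (insert w S) k a w"
    using R by (auto simp: route_def)
  have "walk_le E (insert v (insert w S)) k a w"
    by (rule walk_le_mono[OF walk]) auto
  also have "walk_le E (insert v (insert w S)) 1 w v"
    using \<open>E w v\<close> by (intro walk_le_edge) auto
  finally have "walk_le E (insert v (insert w S)) (Suc k) a v" by simp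
  moreover have "insert w S \<subseteq> V - {u, v}"
    using route_subset[OF R] assms(3-6) by blast
  ultimately show ?thesis
    using a unfolding route_def by blast
qed

lemma route_imp_gpath:
  assumes "route E V u v k S" "u \<in> V" "v \<in> V" "u \<noteq> v"
  obtains p where "gpath V E p u v" "plen p \<le> Suc k" "set p \<subseteq> insert u (insert v S)" "set p \<inter> S \<noteq> {}"
proof -
  obtain a where a: "a \<in> S" "E u a" "walk_le E (insert v S) k a v" and S: "S \<subseteq> V - {u, v}"
    using assms(1) by (auto simp: route_def)
  obtain p where p: "gpath (insert v S) E p a v" "plen p \<le> k"
    using walk_le_imp_gpath[OF a(3)] by auto
  have p_sub: "set p \<subseteq> insert v S" "a \<in> set p" using p(1) by (auto simp: gpath_def)
  show ?thesis
  proof (rule that)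
    show "gpath V E (u # p) u v"
      using gpath_Cons[where V = V, OF gpath_mono[OF p(1)] a(2)] p_sub S assms(2-4) by auto
    show "plen (u # p) \<le> Suc k" using p by (auto simp: plen_def)
    show "set (u # p) \<subseteq> insert u (insert v S)" "set (u # p) \<inter> S \<noteq> {}" using p_sub a(1) by auto
  qed
qed

definition routing :: "('a \<Rightarrow> 'a \<Rightarrow> bool) \<Rightarrow> 'a set \<Rightarrow> 'a \<Rightarrow> 'a \<Rightarrow> nat \<Rightarrow> nat \<Rightarrow> 'a set \<Rightarrow> bool" where
  "routing E V u v k n U \<longleftrightarrow> (\<exists>\<S>. finite \<S> \<and> card \<S> = n \<and> disjoint \<S> \<and>
     (\<forall>S\<in>\<S>. route E V u v k S \<and> S \<subseteq> U))"

lemma routing_family: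
  assumes "finite I" and R: "\<And>i. i \<in> I \<Longrightarrow> route E V u v k (S i)" and disj: "disjoint_family_on S I"
  shows "routing E V u v k (card I) (\<Union>i\<in>I. S i)"
proof -
  have "inj_on S I"
    using disj route_nonempty[OF R] unfolding disjoint_family_on_def inj_on_def by (metis Int_absorb)
  moreover have "disjoint (S ` I)"
    using disj by (rule disjoint_family_on_disjoint_image)
  ultimately show ?thesis
    unfolding routing_def using assms(1) R
    by (intro exI[of _ "S ` I"]) (auto simp: card_image)
qed

lemma routing_insert:
  assumes "routing E V u v k n U" and R: "route E V u v k S" and "S \<inter> U = {}"
  shows "routing E V u v k (Suc n) (U \<union> S)"
proof -
  obtain \<S> where \<S>: "finite \<S>" "card \<S> = n" "disjoint \<S>" "\<forall>S\<in>\<S>. route E V u v k S \<and> S \<subseteq> U"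
    using assms(1) unfolding routing_def by auto
  have "S \<notin> \<S>" using route_nonempty[OF R] assms(3) \<S>(4) by blast
  moreover have "disjoint (insert S \<S>)"
    using \<S>(3,4) assms(3) unfolding pairwise_def disjnt_def by blast
  ultimately show ?thesis
    unfolding routing_def using \<S> R by (intro exI[of _ "insert S \<S>"]) auto
qed

lemma routing_imp_disj_paths:
  assumes "routing E V u v k n U" and uv: "u \<in> V" "v \<in> V" "u \<noteq> v"
  obtains P where "disj_paths V E n u v P" "\<forall>p\<in>P. plen p \<le> Suc k" "[u, v] \<notin> P"
proof -
  obtain \<S> where \<S>: "finite \<S>" "card \<S> = n" "disjoint \<S>" "\<And>S. S \<in> \<S> \<Longrightarrow> route E V u v k S"
    using assms(1) unfolding routing_def by auto
  have "\<forall>S\<in>\<S>. \<exists>p. gpath V E p u v \<and> plen p \<le> Suc k \<and> set p \<subseteq> insert u (insert v S) \<and> set p \<inter> S \<noteq> {}"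
    using route_imp_gpath[OF \<S>(4) uv] by metis
  then obtain f where path: "\<And>S. S \<in> \<S> \<Longrightarrow> gpath V E (f S) u v"
    and len: "\<And>S. S \<in> \<S> \<Longrightarrow> plen (f S) \<le> Suc k"
    and sub: "\<And>S. S \<in> \<S> \<Longrightarrow> set (f S) \<subseteq> insert u (insert v S)"
    and meets: "\<And>S. S \<in> \<S> \<Longrightarrow> set (f S) \<inter> S \<noteq> {}"
    by metis
  have interior: "\<not> set (f S) \<subseteq> {u, v}" if "S \<in> \<S>" for S
    using meets[OF that] route_subset[OF \<S>(4)[OF that]] by blast
  have disj: "set (f S) \<inter> set (f T) \<subseteq> {u, v}" if "S \<in> \<S>" "T \<in> \<S>" "S \<noteq> T" for S T
    using sub[OF that(1)] sub[OF that(2)] \<S>(3) that unfolding pairwise_def disjnt_def by blast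
  show ?thesis
  proof (rule that)
    have "inj_on f \<S>"
      using disj interior by (metis Int_absorb inj_onI)
    then have "card (f ` \<S>) = n" using \<S>(2) by (simp add: card_image)
    moreover have "set p \<inter> set q \<subseteq> {u, v}" if "p \<in> f ` \<S>" "q \<in> f ` \<S>" "p \<noteq> q" for p q
      using disj that by blast
    ultimately show "disj_paths V E n u v (f ` \<S>)"
      unfolding disj_paths_def using \<S>(1) path by simp
    show "\<forall>p\<in>f ` \<S>. plen p \<le> Suc k" using len by auto
    show "[u, v] \<notin> f ` \<S>"
    proof
      assume "[u, v] \<in> f ` \<S>"
      then obtain S where "S \<in> \<S>" "f S = [u, v]" by force
      then show False using interior[of S] by simp
    qed
  qed
qed

lemma routing_imp_linkable:
  assumes "routing E V u v k n U" "u \<in> V" "v \<in> V" "u \<noteq> v"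
  shows "linkable V E n (Suc k) u v"
  using routing_imp_disj_paths[OF assms] unfolding linkable_def by metis

lemma routing_imp_linkable_adjacent:
  assumes "routing E V u v k n U" "u \<in> V" "v \<in> V" "u \<noteq> v" "E u v"
  shows "linkable V E (Suc n) (Suc k) u v"
proof -
  obtain P where P: "disj_paths V E n u v P" "\<forall>p\<in>P. plen p \<le> Suc k" "[u, v] \<notin> P"
    using routing_imp_disj_paths[OF assms(1-4)] .
  have "gpath V E [u, v] u v" using assms(2-5) by (auto simp: gpath_def)
  then have "disj_paths V E (Suc n) u v (insert [u, v] P)"
    using P(1,3) unfolding disj_paths_def by auto
  moreover have "\<forall>p\<in>insert [u, v] P. plen p \<le> Suc k"
    using P(2) by (simp add: plen_def)
  ultimately show ?thesis unfolding linkable_def by blast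
qed

section \<open>Bounds for the fault diameter and the wide diameter\<close>

lemma disj_paths_avoiding:
  assumes P: "disj_paths V E n u v P" and F: "finite F" "card F < n" "F \<inter> {u, v} = {}"
  obtains p where "p \<in> P" "gpath (V - F) E p u v"
proof -
  have "\<exists>p\<in>P. set p \<inter> F = {}"
  proof (rule ccontr)
    assume "\<not> (\<exists>p\<in>P. set p \<inter> F = {})"
    then have "\<forall>p\<in>P. \<exists>x. x \<in> set p \<inter> F" by blast
    then obtain g where g: "\<And>p. p \<in> P \<Longrightarrow> g p \<in> set p \<inter> F" by metis
    have "inj_on g P"
    proof (rule inj_onI, rule ccontr)
      fix p q assume pq: "p \<in> P" "q \<in> P" "g p = g q" "p \<noteq> q"
      then have "set p \<inter> set q \<subseteq> {u, v}" using P unfolding disj_paths_def by blast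
      then show False using g[of p] g[of q] F(3) pq by auto
    qed
    then have "card P \<le> card F" using g F(1) by (intro card_inj_on_le[of g]) auto
    then show False using P F(2) by (auto simp: disj_paths_def)
  qed
  then obtain p where "p \<in> P" "set p \<inter> F = {}" by blast
  moreover from this have "gpath (V - F) E p u v" using P by (auto simp: disj_paths_def gpath_def)
  ultimately show ?thesis using that by blast
qed

lemma fault_diam_le_wide_diam: "fault_diam V E n \<le> wide_diam V E (Suc n)"
  unfolding fault_diam_def
proof (rule Sup_least, clarify)
  fix u v F
  assume uv: "u \<in> V" "v \<in> V" "u \<noteq> v" and F: "F \<subseteq> V - {u, v}" "finite F" "n = card F"
  have "gdist (V - F) E u v \<le> Sup ((\<lambda>p. enat (plen p)) ` P)"
    if P: "disj_paths V E (Suc n) u v P" for P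
  proof -
    obtain p where p: "p \<in> P" "gpath (V - F) E p u v"
      using disj_paths_avoiding[OF P, of F] F by blast
    then have "gdist (V - F) E u v \<le> enat (plen p)"
      unfolding gdist_def by (auto intro: Inf_lower)
    also have "\<dots> \<le> Sup ((\<lambda>p. enat (plen p)) ` P)" using p by (auto intro: Sup_upper)
    finally show ?thesis .
  qed
  then have "gdist (V - F) E u v \<le> Inf {Sup ((\<lambda>p. enat (plen p)) ` P) | P. disj_paths V E (Suc n) u v P}"
    by (auto intro!: Inf_greatest)
  also have "\<dots> \<le> wide_diam V E (Suc n)"
    unfolding wide_diam_def using uv by (intro Sup_upper) auto
  finally show "gdist (V - F) E u v \<le> wide_diam V E (Suc (card F))" using F(3) by simp
qed

lemma wide_diam_le:
  assumes "\<And>u v. u \<in> V \<Longrightarrow> v \<in> V \<Longrightarrow> u \<noteq> v \<Longrightarrow> linkable V E n k u v"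
  shows "wide_diam V E n \<le> enat k"
  unfolding wide_diam_def
proof (rule Sup_least, clarify)
  fix u v assume "u \<in> V" "v \<in> V" "u \<noteq> v"
  then obtain P where P: "disj_paths V E n u v P" "\<forall>p\<in>P. plen p \<le> k"
    using assms unfolding linkable_def by blast
  have "Inf {Sup ((\<lambda>p. enat (plen p)) ` P) | P. disj_paths V E n u v P} \<le> Sup ((\<lambda>p. enat (plen p)) ` P)"
    using P by (auto intro: Inf_lower)
  also have "\<dots> \<le> enat k" using P(2) by (auto intro!: Sup_least)
  finally show "Inf {Sup ((\<lambda>p. enat (plen p)) ` P) | P. disj_paths V E n u v P} \<le> enat k" .
qed

lemma gpath_potential:
  fixes h :: "'a \<Rightarrow> nat"
  assumes p: "gpath V E p u v" and h: "\<And>x y. x \<in> V \<Longrightarrow> y \<in> V \<Longrightarrow> E x y \<Longrightarrow> h x \<le> h y + 1"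
  shows "h u \<le> h v + plen p"
proof -
  have V: "p ! i \<in> V" if "i < length p" for i
    using gpath_set_subset[OF p] nth_mem[OF that] by blast
  have prefix: "h (p ! 0) \<le> h (p ! i) + i" if "i < length p" for i
    using that
  proof (induction i)
    case (Suc i)
    then have "E (p ! i) (p ! Suc i)" using p by (simp add: gpath_def)
    then have "h (p ! i) \<le> h (p ! Suc i) + 1" using h V Suc by simp
    then show ?case using Suc by simp
  qed simp
  have "p \<noteq> []" "hd p = u" "last p = v" using p by (auto simp: gpath_def)
  then show ?thesis using prefix[of "length p - 1"] by (simp add: hd_conv_nth last_conv_nth plen_def)
qed

lemma gpath_tl:
  assumes "gpath V E p u v" "u \<noteq> v"
  obtains w where "w \<in> V" "E u w" "gpath V E (tl p) w v" "plen p = Suc (plen (tl p))"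
proof -
  have len: "2 \<le> length p"
    using assms by (cases p rule: remdups_adj.cases) (auto simp: gpath_def)
  have "p ! 1 \<in> V" using gpath_set_subset[OF assms(1)] nth_mem[of 1 p] len by auto
  moreover have "E (p ! 0) (p ! (0 + 1))" using assms len unfolding gpath_def by simp
  then have "E u (p ! 1)" using assms by (auto simp: gpath_def hd_conv_nth)
  moreover have "gpath V E (tl p) (p ! 1) v"
    using gpath_drop[OF assms(1), of 1] len by (simp add: drop_Suc)
  ultimately show ?thesis using len that by (auto simp: plen_def)
qed

lemma fault_diam_ge_potential:
  fixes h :: "'a \<Rightarrow> nat"
  assumes h: "\<And>x y. x \<in> V \<Longrightarrow> y \<in> V \<Longrightarrow> E x y \<Longrightarrow> h x \<le> h y + 1"
    and uv: "u \<in> V" "v \<in> V" "u \<noteq> v" "\<not> E u u" "\<not> E u v" and w: "w \<in> V" "E u w"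
    and degree: "card {x \<in> V. E u x} = Suc n"
  shows "enat (Suc (h w - h v)) \<le> fault_diam V E n"
proof -
  define F where "F = {x \<in> V. E u x} - {w}"
  have "finite {x \<in> V. E u x}" using degree by (simp add: card_ge_0_finite)
  then have F: "F \<subseteq> V - {u, v}" "finite F" "card F = n"
    using uv w degree by (auto simp: F_def)
  have "Suc (h w - h v) \<le> plen p" if p: "gpath (V - F) E p u v" for p
  proof -
    obtain w' where w': "w' \<in> V - F" "E u w'" "gpath (V - F) E (tl p) w' v" "plen p = Suc (plen (tl p))"
      using gpath_tl[OF p uv(3)] .
    have "w' = w" using w' by (auto simp: F_def)
    have "h w' \<le> h v + plen (tl p)"
      by (rule gpath_potential[OF w'(3)]) (use h in auto)
    then show ?thesis using w'(4) \<open>w' = w\<close> by simp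
  qed
  then have "enat (Suc (h w - h v)) \<le> gdist (V - F) E u v"
    unfolding gdist_def by (auto intro!: Inf_greatest)
  also have "\<dots> \<le> fault_diam V E n"
    unfolding fault_diam_def using uv F by (intro Sup_upper) blast
  finally show ?thesis .
qed

section \<open>Matchings of two finite sets\<close>

definition is_matching :: "'a set \<Rightarrow> 'b set \<Rightarrow> ('a \<times> 'b) set \<Rightarrow> bool" where
  "is_matching A B M \<longleftrightarrow> finite M \<and> M \<subseteq> A \<times> B \<and> inj_on fst M \<and> inj_on snd M"

lemma is_matching_insert:
  assumes "is_matching (A - {a}) (B - {b}) M" "a \<in> A" "b \<in> B"
  shows "is_matching A B (insert (a, b) M)" "card (insert (a, b) M) = Suc (card M)"
proof -
  have "(a, b) \<notin> M" "finite M"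
    using assms(1) unfolding is_matching_def by auto
  then show "card (insert (a, b) M) = Suc (card M)" by simp
  show "is_matching A B (insert (a, b) M)"
    using assms unfolding is_matching_def by fastforce
qed

lemma is_matching_fst_unique: "is_matching A B M \<Longrightarrow> (a, b) \<in> M \<Longrightarrow> (a, b') \<in> M \<Longrightarrow> b = b'"
  unfolding is_matching_def inj_on_def by fastforce

lemma is_matching_snd_unique: "is_matching A B M \<Longrightarrow> (a, b) \<in> M \<Longrightarrow> (a', b) \<in> M \<Longrightarrow> a = a'"
  unfolding is_matching_def inj_on_def by fastforce

lemma ex_matching:
  assumes "finite A" "finite B" "k \<le> card A" "k \<le> card B"
  shows "\<exists>M. is_matching A B M \<and> card M = k"
  using assms
proof (induction k arbitrary: A B)
  case 0
  have "is_matching A B {}" by (simp add: is_matching_def)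
  then show ?case by fastforce
next
  case (Suc k)
  then obtain a b where ab: "a \<in> A" "b \<in> B"
    by (metis card.empty ex_in_conv not_less_eq_eq zero_le)
  have "\<exists>M. is_matching (A - {a}) (B - {b}) M \<and> card M = k"
    by (rule Suc.IH) (use Suc.prems ab in auto)
  then show ?case using is_matching_insert ab by metis
qed

lemma ex_matching_through:
  assumes "finite A" "finite B" "Suc k \<le> card A" "Suc k \<le> card B" "a \<in> A" "b \<in> B"
  obtains M where "is_matching A B M" "card M = Suc k" "(a, b) \<in> M"
proof -
  have "\<exists>M. is_matching (A - {a}) (B - {b}) M \<and> card M = k"
    by (rule ex_matching) (use assms in auto)
  then obtain M where "is_matching (A - {a}) (B - {b}) M" "card M = k" by blast
  from is_matching_insert[OF this(1) assms(5,6)] show ?thesis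
    using that[of "insert (a, b) M"] \<open>card M = k\<close> by simp
qed

text \<open>It suffices to prescribe one pair that shares exactly one entry with each forbidden pair.\<close>
lemma ex_matching_avoiding:
  assumes fin: "finite A" "finite B" and "Suc k \<le> card A" "Suc k \<le> card B" "2 \<le> k"
    and "a1 \<in> A" "b2 \<in> B"
  obtains M where "is_matching A B M" "card M = Suc k" "(a1, b1) \<notin> M" "(a2, b2) \<notin> M"
proof -
  have third: "\<exists>x\<in>S. x \<noteq> y \<and> x \<noteq> z" if "3 \<le> card S" for S :: "'c set" and y z
  proof (rule ccontr)
    assume "\<not> ?thesis"
    then have "card S \<le> card {y, z}" by (intro card_mono) auto
    also have "\<dots> \<le> 2" by (simp add: card_insert_if)
    finally show False using that by simp
  qed
  obtain a b where ab: "a \<in> A" "b \<in> B" "(a = a1) \<noteq> (b = b1)" "(a = a2) \<noteq> (b = b2)"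
  proof (cases "a1 = a2")
    case True
    obtain b where "b \<in> B" "b \<noteq> b1" "b \<noteq> b2" using third[of B b1 b2] assms by auto
    then show ?thesis using that[of a1 b] True \<open>a1 \<in> A\<close> by auto
  next
    case ne: False
    show ?thesis
    proof (cases "b1 = b2")
      case True
      obtain a where "a \<in> A" "a \<noteq> a1" "a \<noteq> a2" using third[of A a1 a2] assms by auto
      then show ?thesis using that[of a b2] True \<open>b2 \<in> B\<close> by auto
    next
      case False
      then show ?thesis using that[of a1 b2] ne assms by auto
    qed
  qed
  obtain M where M: "is_matching A B M" "card M = Suc k" "(a, b) \<in> M"
    using ex_matching_through[OF fin assms(3,4) ab(1,2)] .
  have "(a1, b1) \<notin> M" "(a2, b2) \<notin> M"
    using is_matching_fst_unique[OF M(1,3)] is_matching_snd_unique[OF M(1,3)] ab(3,4) by blast+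
  then show ?thesis using that M by blast
qed

section \<open>Hamming graphs\<close>

definition hamming :: "'a list \<Rightarrow> 'a list \<Rightarrow> nat" where
  "hamming X Y = card {i. i < length X \<and> X ! i \<noteq> Y ! i}"

lemma hamming_le_length: "hamming X Y \<le> length X"
  unfolding hamming_def using card_mono[of "{..<length X}" "{i. i < length X \<and> X ! i \<noteq> Y ! i}"] by auto

lemma hamming_less_length:
  assumes "i < length X" "X ! i = Y ! i"
  shows "hamming X Y < length X"
proof -
  have "{i. i < length X \<and> X ! i \<noteq> Y ! i} \<subset> {..<length X}" using assms by auto
  from psubset_card_mono[OF finite_lessThan this] show ?thesis by (simp add: hamming_def)
qed

lemma hamming_eq_length:
  assumes "\<And>i. i < length X \<Longrightarrow> X ! i \<noteq> Y ! i"
  shows "hamming X Y = length X"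
proof -
  have "{i. i < length X \<and> X ! i \<noteq> Y ! i} = {..<length X}" using assms by auto
  then show ?thesis by (simp add: hamming_def)
qed

lemma hamming_eq_0: "length X = length Y \<Longrightarrow> hamming X Y = 0 \<longleftrightarrow> X = Y"
  unfolding hamming_def by (auto simp: list_eq_iff_nth_eq)

lemma hamming_self [simp]: "hamming X X = 0"
  by (simp add: hamming_def)

lemma hamming_triangle:
  assumes "length X = length Y"
  shows "hamming X Z \<le> hamming X Y + hamming Y Z"
proof -
  have "hamming X Z \<le> card ({i. i < length X \<and> X ! i \<noteq> Y ! i} \<union> {i. i < length Y \<and> Y ! i \<noteq> Z ! i})"
    unfolding hamming_def using assms by (intro card_mono) auto
  also have "\<dots> \<le> hamming X Y + hamming Y Z" unfolding hamming_def by (rule card_Un_le)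
  finally show ?thesis .
qed

lemma differ_one_iff_hamming: "differ_one X Y \<longleftrightarrow> length X = length Y \<and> hamming X Y = 1"
  by (simp add: differ_one_def hamming_def)

lemma hamming_le_differ_one: "differ_one X Y \<Longrightarrow> hamming X Z \<le> hamming Y Z + 1"
  using hamming_triangle[of X Y Z] by (simp add: differ_one_iff_hamming)

lemma differ_one_sym: "differ_one X Y \<Longrightarrow> differ_one Y X"
  unfolding differ_one_def by (auto simp: eq_commute[of "Y ! _"])

lemma differ_one_irrefl [simp]: "\<not> differ_one X X"
  by (simp add: differ_one_def)

lemma differ_one_update:
  assumes "i < length X" "c \<noteq> X ! i"
  shows "differ_one X (X[i := c])"
proof -
  have "{j. j < length X \<and> X ! j \<noteq> X[i := c] ! j} = {i}"
    using assms by (auto simp: nth_list_update)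
  then show ?thesis by (simp add: differ_one_def)
qed

lemma differ_oneE:
  assumes "differ_one X Y"
  obtains i c where "i < length X" "c \<noteq> X ! i" "Y = X[i := c]"
proof -
  have len: "length X = length Y" and "card {i. i < length X \<and> X ! i \<noteq> Y ! i} = 1"
    using assms by (auto simp: differ_one_def)
  then obtain i where i: "{i. i < length X \<and> X ! i \<noteq> Y ! i} = {i}"
    by (auto simp: card_1_singleton_iff)
  then have "X ! p = Y ! p" if "p < length X" "p \<noteq> i" for p using that by blast
  moreover have "i < length X" "Y ! i \<noteq> X ! i" using i by force+
  ultimately have "Y = X[i := Y ! i]"
    using len by (intro nth_equalityI) (auto simp: nth_list_update)
  then show ?thesis using \<open>i < length X\<close> \<open>Y ! i \<noteq> X ! i\<close> by (rule that[rotated 2])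
qed

lemma update_in_lists: "X \<in> lists \<Sigma> \<Longrightarrow> c \<in> \<Sigma> \<Longrightarrow> X[i := c] \<in> lists \<Sigma>"
  using set_update_subset_insert[of X i c] by auto

definition word_nbrs :: "nat set \<Rightarrow> nat list \<Rightarrow> nat list set" where
  "word_nbrs \<Sigma> X = {P \<in> lists \<Sigma>. differ_one X P}"

lemma word_nbrs_eq_updates:
  assumes "X \<in> lists \<Sigma>"
  shows "word_nbrs \<Sigma> X = (\<lambda>(i, c). X[i := c]) ` (SIGMA i:{..<length X}. \<Sigma> - {X ! i})"
proof (intro equalityI subsetI)
  fix P assume P: "P \<in> word_nbrs \<Sigma> X"
  then obtain i c where P_update: "i < length X" "c \<noteq> X ! i" "P = X[i := c]"
    by (auto simp: word_nbrs_def elim: differ_oneE)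
  have "P ! i \<in> \<Sigma>"
    using P nth_mem[of i P] P_update(1,3) by (auto simp: word_nbrs_def)
  then show "P \<in> (\<lambda>(i, c). X[i := c]) ` (SIGMA i:{..<length X}. \<Sigma> - {X ! i})"
    using P_update by force
next
  fix P assume "P \<in> (\<lambda>(i, c). X[i := c]) ` (SIGMA i:{..<length X}. \<Sigma> - {X ! i})"
  then obtain i c where "i < length X" "c \<in> \<Sigma>" "c \<noteq> X ! i" "P = X[i := c]" by auto
  then show "P \<in> word_nbrs \<Sigma> X"
    unfolding word_nbrs_def using update_in_lists[OF assms] differ_one_update by blast
qed

lemma inj_on_list_update: "inj_on (\<lambda>(i, c). X[i := c]) (SIGMA i:{..<length X}. \<Sigma> - {X ! i})"
proof (rule inj_onI)
  let ?I = "SIGMA i:{..<length X}. \<Sigma> - {X ! i}"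
  fix x y assume xy: "x \<in> ?I" "y \<in> ?I" "(\<lambda>(i, c). X[i := c]) x = (\<lambda>(i, c). X[i := c]) y"
  obtain i c j e where "x = (i, c)" "y = (j, e)" by fastforce
  then show "x = y" using xy by simp (metis nth_list_update_eq nth_list_update_neq)
qed

lemma card_word_nbrs:
  assumes "finite \<Sigma>" and X: "X \<in> lists \<Sigma>"
  shows "card (word_nbrs \<Sigma> X) = length X * (card \<Sigma> - 1)"
proof -
  have "card (\<Sigma> - {X ! i}) = card \<Sigma> - 1" if "i < length X" for i
    using that X by (simp add: in_lists_conv_set)
  then show ?thesis
    unfolding word_nbrs_eq_updates[OF X] using assms(1)
    by (simp add: card_image inj_on_list_update card_SigmaI)
qed

lemma finite_word_nbrs: "finite \<Sigma> \<Longrightarrow> X \<in> lists \<Sigma> \<Longrightarrow> finite (word_nbrs \<Sigma> X)"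
  by (simp add: word_nbrs_eq_updates)

definition word_box :: "'a list \<Rightarrow> 'a list \<Rightarrow> 'a list set" where
  "word_box X Y = {W. length W = length X \<and> (\<forall>i<length X. W ! i = X ! i \<or> W ! i = Y ! i)}"

lemma word_box_ends: "X \<in> word_box X Y" "length X = length Y \<Longrightarrow> Y \<in> word_box X Y"
  by (auto simp: word_box_def)

lemma walk_le_word_box:
  assumes "length X = length Y"
  shows "walk_le differ_one (word_box X Y) (hamming X Y) X Y"
  using assms
proof (induction "hamming X Y" arbitrary: X)
  case 0
  then have "X = Y" using hamming_eq_0 by metis
  then show ?case by (simp add: walk_le.refl word_box_ends)
next
  case (Suc n)
  then obtain i where i: "i < length X" "X ! i \<noteq> Y ! i"
    by (metis hamming_eq_0 list_eq_iff_nth_eq nat.distinct(1))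
  define W where "W = X[i := Y ! i]"
  have "{j. j < length X \<and> X ! j \<noteq> Y ! j} = insert i {j. j < length W \<and> W ! j \<noteq> Y ! j}"
    using i by (auto simp: W_def nth_list_update)
  then have "hamming X Y = Suc (hamming W Y)" unfolding hamming_def by (simp add: W_def i)
  then have n: "n = hamming W Y" using Suc by simp
  have "word_box W Y \<subseteq> word_box X Y"
    unfolding word_box_def W_def using i(1) by (auto simp: nth_list_update)
  then have "walk_le differ_one (word_box X Y) n W Y"
    using Suc(1)[OF n] Suc.prems n by (auto simp: W_def intro: walk_le_mono)
  moreover have "differ_one X W" using differ_one_update[OF i(1)] i(2) by (auto simp: W_def)
  ultimately show ?case
    unfolding Suc(2)[symmetric] by (intro walk_le.step word_box_ends)
qed

definition cyc_dist :: "nat \<Rightarrow> nat \<Rightarrow> nat \<Rightarrow> nat" where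
  "cyc_dist k i p = (if i \<le> p then p - i else p + k - i)"

lemma inj_on_cyc_dist: "i < k \<Longrightarrow> inj_on (cyc_dist k i) {..<k}"
  by (auto simp: inj_on_def cyc_dist_def split: if_splits)

lemma cyc_dist_less: "i < k \<Longrightarrow> p < k \<Longrightarrow> cyc_dist k i p < k"
  by (auto simp: cyc_dist_def)

definition cyc_mix :: "'a list \<Rightarrow> 'a list \<Rightarrow> nat \<Rightarrow> nat \<Rightarrow> 'a list" where
  "cyc_mix X Y i l = map (\<lambda>p. if cyc_dist (length X) i p < l then Y ! p else X ! p) [0..<length X]"

lemma cyc_mix_nth [simp]:
  "p < length X \<Longrightarrow> cyc_mix X Y i l ! p = (if cyc_dist (length X) i p < l then Y ! p else X ! p)"
  by (simp add: cyc_mix_def)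

lemma length_cyc_mix [simp]: "length (cyc_mix X Y i l) = length X"
  by (simp add: cyc_mix_def)

lemma cyc_mix_length: "length X = length Y \<Longrightarrow> i < length X \<Longrightarrow> cyc_mix X Y i (length X) = Y"
  by (intro nth_equalityI) (auto simp: cyc_dist_less)

lemma cyc_mix_1: "i < length X \<Longrightarrow> cyc_mix X Y i 1 = X[i := Y ! i]"
  by (intro nth_equalityI) (auto simp: cyc_dist_def nth_list_update)

lemma cyc_mix_Suc:
  assumes "i < length X"
  shows "cyc_mix X Y i (Suc l) = cyc_mix X Y i l \<or> differ_one (cyc_mix X Y i l) (cyc_mix X Y i (Suc l))"
proof -
  let ?W = "cyc_mix X Y i l" and ?W' = "cyc_mix X Y i (Suc l)"
  let ?D = "{p. p < length ?W \<and> ?W ! p \<noteq> ?W' ! p}"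
  have dist_eq: "cyc_dist (length X) i p = l" if "p \<in> ?D" for p
    using that by (auto split: if_splits)
  have "\<forall>p\<in>?D. \<forall>q\<in>?D. p = q"
    using inj_onD[OF inj_on_cyc_dist[OF assms]] dist_eq
    by (metis (lifting) length_cyc_mix lessThan_iff mem_Collect_eq)
  moreover have "finite ?D" by simp
  ultimately have "hamming ?W ?W' \<le> Suc 0"
    unfolding hamming_def using card_le_Suc0_iff_eq by blast
  then consider (equal) "hamming ?W ?W' = 0" | (adjacent) "hamming ?W ?W' = 1" by linarith
  then show ?thesis
  proof cases
    case equal
    then show ?thesis using hamming_eq_0[of ?W ?W'] by simp
  next
    case adjacent
    then show ?thesis by (simp add: differ_one_iff_hamming)
  qed
qed

lemma walk_le_cyc_mix:
  assumes "length X = length Y" "i < length X" "1 \<le> l" "l \<le> length X"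
  shows "walk_le differ_one {cyc_mix X Y i l |l. 1 \<le> l} (length X - l) (cyc_mix X Y i l) Y"
proof -
  have "walk_le differ_one {cyc_mix X Y i l |l. 1 \<le> l} (length X - l) (cyc_mix X Y i l)
      (cyc_mix X Y i (length X))"
    by (rule walk_le_chain) (use assms cyc_mix_Suc in auto)
  then show ?thesis unfolding cyc_mix_length[OF assms(1,2)] .
qed

text \<open>The two arcs of corrected positions contain each other's starting points, so they cover everything.\<close>
lemma cyc_mix_eq_imp_complete:
  assumes eq: "cyc_mix X Y i l = cyc_mix X Y j m" and len: "length X = length Y"
    and starts: "i < length X" "j < length X" "i \<noteq> j" "X ! i \<noteq> Y ! i" "X ! j \<noteq> Y ! j"
    and arcs_nonempty: "1 \<le> l" "1 \<le> m"
  shows "cyc_mix X Y i l = Y"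
proof (rule nth_equalityI)
  let ?d = "cyc_dist (length X)"
  have nth_eq: "cyc_mix X Y i l ! p = cyc_mix X Y j m ! p" for p using eq by simp
  have "?d j i < m" using nth_eq[of i] starts arcs_nonempty by (auto simp: cyc_dist_def split: if_splits)
  moreover have "?d i j < l" using nth_eq[of j] starts arcs_nonempty by (auto simp: cyc_dist_def split: if_splits)
  moreover fix p assume "p < length (cyc_mix X Y i l)"
  then have p: "p < length X" by simp
  then have "?d i p \<le> ?d i j \<or> ?d j p \<le> ?d j i"
    using starts by (auto simp: cyc_dist_def)
  ultimately have "?d i p < l \<or> ?d j p < m" by linarith
  then show "cyc_mix X Y i l ! p = Y ! p" using nth_eq[of p] p by auto
qed (use len in simp)

definition diff_pos :: "'a list \<Rightarrow> 'a list \<Rightarrow> nat" where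
  "diff_pos X P = (LEAST i. X ! i \<noteq> P ! i)"

lemma diff_pos_update: "i < length X \<Longrightarrow> c \<noteq> X ! i \<Longrightarrow> diff_pos X (X[i := c]) = i"
  unfolding diff_pos_def by (rule Least_equality) (auto, metis nth_list_update_neq order_refl)

text \<open>Pairwise disjoint vertex sets of paths from the neighbours \<open>P\<close> of \<open>X\<close> to \<open>Y\<close>. A neighbour
  \<open>X[i := c]\<close> with \<open>c \<noteq> Y ! i\<close> keeps the letter \<open>c\<close> until its last step, and \<open>X[i := Y ! i]\<close> corrects the
  positions in cyclic order starting at \<open>i\<close>.\<close>
definition fan :: "'a list \<Rightarrow> 'a list \<Rightarrow> 'a list \<Rightarrow> 'a list set" where
  "fan X Y P = (let i = diff_pos X P in
     if P ! i = Y ! i then {cyc_mix X Y i l |l. 1 \<le> l} - {Y} else word_box P (Y[i := P ! i]))"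

lemma fan_update:
  assumes "i < length X" "c \<noteq> X ! i"
  shows "fan X Y (X[i := c]) =
    (if c = Y ! i then {cyc_mix X Y i l |l. 1 \<le> l} - {Y} else word_box (X[i := c]) (Y[i := c]))"
  using assms by (simp add: fan_def diff_pos_update)

lemma fan_nth:
  assumes "length X = length Y" "i < length X" "c \<noteq> X ! i" and W: "W \<in> fan X Y (X[i := c])"
  shows "length W = length X" "W ! i = c" "\<And>p. p < length X \<Longrightarrow> p \<noteq> i \<Longrightarrow> W ! p \<in> {X ! p, Y ! p}"
  using W assms(1-3) unfolding fan_update[OF assms(2,3)]
  by (auto simp: cyc_dist_def word_box_def split: if_splits)

lemma fan_subset_lists:
  assumes X: "X \<in> lists \<Sigma>" and Y: "Y \<in> lists \<Sigma>" and len: "length X = length Y"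
    and P: "P \<in> word_nbrs \<Sigma> X"
  shows "fan X Y P \<subseteq> {W \<in> lists \<Sigma>. length W = length X}"
proof
  fix W assume W: "W \<in> fan X Y P"
  obtain i c where P_update: "i < length X" "c \<in> \<Sigma>" "c \<noteq> X ! i" "P = X[i := c]"
    using P unfolding word_nbrs_eq_updates[OF X] by auto
  note nth = fan_nth[OF len P_update(1,3) W[unfolded P_update(4)]]
  have "W ! p \<in> \<Sigma>" if "p < length X" for p
    using nth(2) nth(3)[OF that] that P_update(2) X Y len by (cases "p = i") (auto simp: in_lists_conv_set)
  then show "W \<in> {W \<in> lists \<Sigma>. length W = length X}"
    using nth(1) by (auto simp: in_lists_conv_set in_set_conv_nth)
qed

lemma fan_avoids_ends:
  assumes len: "length X = length Y" and P: "differ_one X P"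
  shows "X \<notin> fan X Y P" "Y \<notin> fan X Y P"
proof -
  obtain i c where P_update: "i < length X" "c \<noteq> X ! i" "P = X[i := c]"
    using P by (rule differ_oneE)
  show "X \<notin> fan X Y P" using fan_nth(2)[OF len P_update(1,2)] P_update by auto
  show "Y \<notin> fan X Y P"
  proof (cases "c = Y ! i")
    case True
    then show ?thesis using P_update by (simp add: fan_update)
  next
    case False
    then show ?thesis using fan_nth(2)[OF len P_update(1,2)] P_update(3) by auto
  qed
qed

lemma start_in_fan:
  assumes "length X = length Y" "differ_one X P" "P \<noteq> Y"
  shows "P \<in> fan X Y P"
proof -
  obtain i c where P_update: "i < length X" "c \<noteq> X ! i" "P = X[i := c]"
    using assms(2) by (rule differ_oneE)
  have "P = cyc_mix X Y i 1" if "c = Y ! i"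
    using that P_update cyc_mix_1[of i X Y] by simp
  then show ?thesis
    using assms(3) P_update by (auto simp: fan_update word_box_ends)
qed

lemma walk_le_fan:
  assumes len: "length X = length Y" and P: "differ_one X P"
  shows "walk_le differ_one (insert Y (fan X Y P)) (length X) P Y"
proof -
  obtain i c where P_update: "i < length X" "c \<noteq> X ! i" "P = X[i := c]"
    using P by (rule differ_oneE)
  show ?thesis
  proof (cases "c = Y ! i")
    case True
    have "walk_le differ_one {cyc_mix X Y i l |l. 1 \<le> l} (length X - 1) (cyc_mix X Y i 1) Y"
      using len P_update by (intro walk_le_cyc_mix) auto
    moreover have "P = cyc_mix X Y i 1" using P_update True cyc_mix_1[of i X Y] by simp
    moreover have "{cyc_mix X Y i l |l. 1 \<le> l} \<subseteq> insert Y (fan X Y P)"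
      using True P_update by (auto simp: fan_update)
    ultimately show ?thesis by (auto intro: walk_le_mono)
  next
    case False
    define W where "W = Y[i := c]"
    have lenW: "length P = length W" by (simp add: W_def P_update len)
    have box: "word_box P W \<subseteq> insert Y (fan X Y P)"
      using False P_update by (auto simp: fan_update W_def)
    have "walk_le differ_one (insert Y (fan X Y P)) (hamming P W) P W"
      using walk_le_word_box[OF lenW] box by (rule walk_le_mono) simp
    also have "walk_le differ_one (insert Y (fan X Y P)) 1 W Y"
    proof (rule walk_le_edge)
      show "W \<in> insert Y (fan X Y P)" using box word_box_ends(2)[OF lenW] by blast
      show "differ_one W Y"
        unfolding W_def using False P_update len by (intro differ_one_sym[OF differ_one_update]) auto
    qed simp
    finally have "walk_le differ_one (insert Y (fan X Y P)) (hamming P W + 1) P Y" .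
    moreover have "hamming P W < length P"
      using P_update len by (intro hamming_less_length[of i]) (auto simp: W_def)
    ultimately show ?thesis using P_update(3) by (auto intro: walk_le_mono)
  qed
qed

lemma fan_disjoint:
  assumes len: "length X = length Y" and P: "differ_one X P" and Q: "differ_one X Q" and "P \<noteq> Q"
  shows "fan X Y P \<inter> fan X Y Q = {}"
proof (rule ccontr)
  assume "\<not> ?thesis"
  then obtain W where WP: "W \<in> fan X Y P" and WQ: "W \<in> fan X Y Q" by blast
  obtain i c where P_update: "i < length X" "c \<noteq> X ! i" "P = X[i := c]"
    using P by (rule differ_oneE)
  obtain j e where Q_update: "j < length X" "e \<noteq> X ! j" "Q = X[j := e]"
    using Q by (rule differ_oneE)
  note nthP = fan_nth[OF len P_update(1,2) WP[unfolded P_update(3)]]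
  note nthQ = fan_nth[OF len Q_update(1,2) WQ[unfolded Q_update(3)]]
  have "i \<noteq> j" using nthP(2) nthQ(2) P_update(3) Q_update(3) \<open>P \<noteq> Q\<close> by auto
  then have "c = Y ! i" "e = Y ! j"
    using nthP(2,3) nthQ(2,3) P_update Q_update by fastforce+
  then obtain l m where "W = cyc_mix X Y i l" "1 \<le> l" "W = cyc_mix X Y j m" "1 \<le> m"
    using WP WQ P_update Q_update by (auto simp: fan_update)
  then have "W = Y"
    using cyc_mix_eq_imp_complete[of X Y i l j m] len P_update Q_update \<open>i \<noteq> j\<close> \<open>c = Y ! i\<close> \<open>e = Y ! j\<close>
    by auto
  then show False using WP fan_avoids_ends(2)[OF len P] by blast
qed

section \<open>Ternary words\<close>

lemma tern_words_eq_lists: "tern_words k = {X \<in> lists {0, 1, 2}. length X = k}"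
  by (auto simp: tern_words_def)

lemma tern_words_length: "X \<in> tern_words k \<Longrightarrow> length X = k"
  by (simp add: tern_words_def)

lemma tern_words_iff: "X \<in> tern_words k \<longleftrightarrow> length X = k \<and> (\<forall>i<k. X ! i \<in> {0, 1, 2})"
  unfolding tern_words_def by (auto simp: in_set_conv_nth subset_iff)

lemma tern_words_update: "X \<in> tern_words k \<Longrightarrow> c \<in> {0, 1, 2} \<Longrightarrow> X[i := c] \<in> tern_words k"
  unfolding tern_words_def using set_update_subset_insert[of X i c] by auto

lemma word_box_subset_tern_words:
  assumes "X \<in> tern_words k" "Y \<in> tern_words k"
  shows "word_box X Y \<subseteq> tern_words k"
proof
  fix W assume "W \<in> word_box X Y"
  then have "length W = k" "\<forall>i<k. W ! i = X ! i \<or> W ! i = Y ! i"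
    using tern_words_length[OF assms(1)] by (simp_all add: word_box_def)
  then show "W \<in> tern_words k"
    using assms unfolding tern_words_iff by metis
qed

lemma walk_le_tern_words:
  assumes "X \<in> tern_words k" "Y \<in> tern_words k" "f ` tern_words k \<subseteq> S"
    and E: "\<And>W W'. differ_one W W' \<Longrightarrow> E (f W) (f W')"
  shows "walk_le E S (hamming X Y) (f X) (f Y)"
proof (rule walk_le_map[where E = differ_one and f = f])
  show "walk_le differ_one (word_box X Y) (hamming X Y) X Y"
    using assms(1,2) by (intro walk_le_word_box) (simp add: tern_words_length)
  show "f ` word_box X Y \<subseteq> S"
    using word_box_subset_tern_words[OF assms(1,2)] assms(3) by blast
qed (rule E)

lemma hamming_tern_words_le: "X \<in> tern_words k \<Longrightarrow> hamming X Y \<le> k"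
  using hamming_le_length[of X Y] by (simp add: tern_words_length)

definition tern_nbrs :: "nat list \<Rightarrow> nat list set" where
  "tern_nbrs X = word_nbrs {0, 1, 2} X"

lemma in_tern_nbrs_iff: "X \<in> tern_words k \<Longrightarrow> P \<in> tern_nbrs X \<longleftrightarrow> P \<in> tern_words k \<and> differ_one X P"
  by (auto simp: tern_nbrs_def word_nbrs_def tern_words_eq_lists differ_one_def)

lemma tern_nbr_neq: "P \<in> tern_nbrs X \<Longrightarrow> P \<noteq> X"
  by (auto simp: tern_nbrs_def word_nbrs_def)

lemma finite_tern_nbrs: "X \<in> tern_words k \<Longrightarrow> finite (tern_nbrs X)"
  by (simp add: tern_nbrs_def tern_words_eq_lists finite_word_nbrs)

lemma card_tern_nbrs: "X \<in> tern_words k \<Longrightarrow> card (tern_nbrs X) = 2 * k"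
  by (simp add: tern_nbrs_def tern_words_eq_lists card_word_nbrs)

lemma fan_subset_tern_words:
  assumes "X \<in> tern_words k" "Y \<in> tern_words k" "P \<in> tern_nbrs X"
  shows "fan X Y P \<subseteq> tern_words k"
  using fan_subset_lists[of X "{0, 1, 2}" Y P] assms by (simp add: tern_words_eq_lists tern_nbrs_def)

definition closed_nbrs :: "nat list \<Rightarrow> nat list set" where
  "closed_nbrs X = insert X (tern_nbrs X)"

lemma in_closed_nbrs_iff:
  "X \<in> tern_words k \<Longrightarrow> P \<in> closed_nbrs X \<longleftrightarrow> P = X \<or> P \<in> tern_words k \<and> differ_one X P"
  by (simp add: closed_nbrs_def in_tern_nbrs_iff)

lemma closed_nbrs_subset: "X \<in> tern_words k \<Longrightarrow> closed_nbrs X \<subseteq> tern_words k"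
  by (auto simp: in_closed_nbrs_iff)

lemma finite_closed_nbrs: "X \<in> tern_words k \<Longrightarrow> finite (closed_nbrs X)"
  by (simp add: closed_nbrs_def finite_tern_nbrs)

lemma card_closed_nbrs: "X \<in> tern_words k \<Longrightarrow> card (closed_nbrs X) = Suc (2 * k)"
  by (simp add: closed_nbrs_def finite_tern_nbrs card_tern_nbrs in_tern_nbrs_iff)

definition detour_words :: "nat \<Rightarrow> nat list \<Rightarrow> nat list \<Rightarrow> nat list set" where
  "detour_words k Z Z' = {W \<in> tern_words k - {Z, Z'}. hamming Z W + hamming W Z' \<le> Suc k}"

lemma ex_detour_word:
  assumes Z: "Z \<in> tern_words k" and Z': "Z' \<in> tern_words k" and "1 \<le> k"
  obtains W where "W \<in> detour_words k Z Z'"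
proof -
  have "\<exists>c\<in>{0, 1, 2::nat}. c \<noteq> a \<and> c \<noteq> b" for a b
    by (cases "a = 0 \<or> b = 0"; cases "a = 1 \<or> b = 1") auto
  then obtain c where c: "c \<in> {0, 1, 2}" "c \<noteq> Z ! 0" "c \<noteq> Z' ! 0" by meson
  have len: "length Z = k" "length Z' = k" using Z Z' tern_words_length by auto
  define W where "W = Z'[0 := c]"
  have "W ! 0 = c" using len assms(3) by (simp add: W_def)
  then have "W \<in> tern_words k - {Z, Z'}"
    using c tern_words_update[OF Z' c(1), of 0] by (auto simp: W_def)
  moreover have "differ_one W Z'"
    unfolding W_def using c len assms(3) by (intro differ_one_sym[OF differ_one_update]) auto
  then have "hamming W Z' = 1" by (simp add: differ_one_iff_hamming)
  ultimately show ?thesis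
    using hamming_tern_words_le[OF Z, of W] by (intro that[of W]) (simp add: detour_words_def)
qed

text \<open>\<open>Q\<close> is the last word before \<open>Y'\<close> on a shortest path from \<open>Y\<close>.\<close>
lemma ex_last_nbr:
  assumes Y: "Y \<in> tern_words k" and Y': "Y' \<in> tern_words k"
  obtains Q where "Q \<in> closed_nbrs Y'" "word_box Y Q \<inter> closed_nbrs Y' = {Q}"
proof (cases "Y = Y'")
  case True
  then have "word_box Y Y' = {Y'}" unfolding word_box_def by (auto simp: list_eq_iff_nth_eq)
  then show ?thesis using that[of Y'] True by (auto simp: closed_nbrs_def)
next
  case False
  have len: "length Y = k" "length Y' = k" using Y Y' tern_words_length by auto
  obtain i where i: "i < k" "Y ! i \<noteq> Y' ! i" using False len by (auto simp: list_eq_iff_nth_eq)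
  define Q where "Q = Y'[i := Y ! i]"
  have Q: "Q \<in> closed_nbrs Y'"
    using differ_one_update[of i Y' "Y ! i"] i len tern_words_update[OF Y'] Y
    by (auto simp: Q_def in_closed_nbrs_iff[OF Y'] tern_words_iff)
  have "W = Q" if "W \<in> word_box Y Q" "W \<in> closed_nbrs Y'" for W
  proof -
    have Wi: "W ! i = Y ! i" using that(1) i len by (auto simp: word_box_def Q_def)
    then have "differ_one Y' W" using that(2) i by (auto simp: in_closed_nbrs_iff[OF Y'])
    then obtain j c where "j < length Y'" "W = Y'[j := c]" by (auto elim: differ_oneE)
    then show ?thesis using Wi i unfolding Q_def by (cases "i = j") auto
  qed
  moreover have "Q \<in> word_box Y Q" using len by (auto simp: word_box_def Q_def)
  ultimately show ?thesis using Q by (intro that[of Q]) auto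
qed

section \<open>Adjacency and symmetries of the exchanged 3-ary cube\<close>

lemma E3C_V_iff [simp]: "(A, B, C, d) \<in> E3C_V r s t \<longleftrightarrow>
    A \<in> tern_words r \<and> B \<in> tern_words s \<and> C \<in> tern_words t \<and> d \<in> {0, 1, 2}"
  by (simp add: E3C_V_def)

lemma E3C_E_irrefl: "\<not> E3C_E x x"
  by (auto simp: E3C_E_def split: prod.splits)

lemma E3C_E_sym: "E3C_E x y \<Longrightarrow> E3C_E y x"
  unfolding E3C_E_def by (auto dest: differ_one_sym split: prod.splits)

lemma E3C_E_layer: "d \<noteq> d' \<Longrightarrow> E3C_E (A, B, C, d) (A, B, C, d')"
  by (auto simp: E3C_E_def)

lemma E3C_E_A: "differ_one A A' \<Longrightarrow> E3C_E (A, B, C, 2) (A', B, C, 2)"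
  by (auto simp: E3C_E_def)

lemma E3C_E_B: "differ_one B B' \<Longrightarrow> E3C_E (A, B, C, 1) (A, B', C, 1)"
  by (auto simp: E3C_E_def)

lemma E3C_E_C: "differ_one C C' \<Longrightarrow> E3C_E (A, B, C, 0) (A, B, C', 0)"
  by (auto simp: E3C_E_def)

lemma card_E3C_nbrs_layer_2:
  assumes "(A, B, C, 2) \<in> E3C_V r s t"
  shows "card {x \<in> E3C_V r s t. E3C_E (A, B, C, 2) x} = 2 * r + 2"
proof -
  have A: "A \<in> tern_words r" using assms by simp
  have "{x \<in> E3C_V r s t. E3C_E (A, B, C, 2) x} =
      (\<lambda>P. (P, B, C, 2)) ` tern_nbrs A \<union> {(A, B, C, 0), (A, B, C, 1)}"
    using assms by (auto simp: E3C_E_def in_tern_nbrs_iff[OF A])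
  moreover have "card ((\<lambda>P. (P, B, C, 2::nat)) ` tern_nbrs A) = 2 * r"
    using card_tern_nbrs[OF A] by (simp add: card_image inj_on_def)
  moreover have "(\<lambda>P. (P, B, C, 2)) ` tern_nbrs A \<inter> {(A, B, C, 0), (A, B, C, 1::nat)} = {}" by auto
  ultimately show ?thesis
    using finite_tern_nbrs[OF A] by (simp add: card_Un_disjoint)
qed

definition swap12 :: "e3c_vertex \<Rightarrow> e3c_vertex" where
  "swap12 = (\<lambda>(A, B, C, d). (B, A, C, transpose 1 2 d))"

definition swap01 :: "e3c_vertex \<Rightarrow> e3c_vertex" where
  "swap01 = (\<lambda>(A, B, C, d). (A, C, B, transpose 0 1 d))"

lemma swap12_swap12 [simp]: "swap12 (swap12 x) = x"
  by (cases x) (simp add: swap12_def)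

lemma swap01_swap01 [simp]: "swap01 (swap01 x) = x"
  by (cases x) (simp add: swap01_def)

lemma inj_swap12: "inj swap12"
  by (metis injI swap12_swap12)

lemma inj_swap01: "inj swap01"
  by (metis injI swap01_swap01)

lemma swap12_image_V: "swap12 ` E3C_V r s t \<subseteq> E3C_V s r t"
  by (auto simp: swap12_def transpose_def)

lemma swap01_image_V: "swap01 ` E3C_V r s t \<subseteq> E3C_V r t s"
  by (auto simp: swap01_def transpose_def)

lemma swap12_E: "E3C_E x y \<Longrightarrow> E3C_E (swap12 x) (swap12 y)"
  by (cases x, cases y) (auto simp: swap12_def E3C_E_def transpose_def split: if_splits)

lemma swap01_E: "E3C_E x y \<Longrightarrow> E3C_E (swap01 x) (swap01 y)"
  by (cases x, cases y) (auto simp: swap01_def E3C_E_def transpose_def split: if_splits)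

lemma linkable_swap12:
  assumes "linkable (E3C_V r s t) E3C_E n k u v"
  shows "linkable (E3C_V s r t) E3C_E n k (swap12 u) (swap12 v)"
  by (rule linkable_map[where f = swap12, OF assms])
    (simp_all add: swap12_E swap12_image_V inj_on_subset[OF inj_swap12])

lemma linkable_swap01:
  assumes "linkable (E3C_V r s t) E3C_E n k u v"
  shows "linkable (E3C_V r t s) E3C_E n k (swap01 u) (swap01 v)"
  by (rule linkable_map[where f = swap01, OF assms])
    (simp_all add: swap01_E swap01_image_V inj_on_subset[OF inj_swap01])

section \<open>Walks in the exchanged 3-ary cube\<close>

lemma walk_le_layer:
  "(A, B, C, d) \<in> S \<Longrightarrow> (A, B, C, d') \<in> S \<Longrightarrow> d \<noteq> d' \<Longrightarrow> walk_le E3C_E S 1 (A, B, C, d) (A, B, C, d')"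
  by (intro walk_le_edge E3C_E_layer)

lemma walk_le_A:
  assumes "A \<in> tern_words r" "A' \<in> tern_words r" "tern_words r \<times> {B} \<times> {C} \<times> {2} \<subseteq> S"
  shows "walk_le E3C_E S (hamming A A') (A, B, C, 2) (A', B, C, 2)"
  by (rule walk_le_tern_words[where f = "\<lambda>A. (A, B, C, 2)", OF assms(1,2)]) (use assms(3) E3C_E_A in auto)

lemma walk_le_B:
  assumes "B \<in> tern_words s" "B' \<in> tern_words s" "{A} \<times> tern_words s \<times> {C} \<times> {1} \<subseteq> S"
  shows "walk_le E3C_E S (hamming B B') (A, B, C, 1) (A, B', C, 1)"
  by (rule walk_le_tern_words[where f = "\<lambda>B. (A, B, C, 1)", OF assms(1,2)]) (use assms(3) E3C_E_B in auto)

lemma walk_le_C: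
  assumes "C \<in> tern_words t" "C' \<in> tern_words t" "{A} \<times> {B} \<times> tern_words t \<times> {0} \<subseteq> S"
  shows "walk_le E3C_E S (hamming C C') (A, B, C, 0) (A, B, C', 0)"
  by (rule walk_le_tern_words[where f = "\<lambda>C. (A, B, C, 0)", OF assms(1,2)]) (use assms(3) E3C_E_C in auto)

lemma walk_le_closed_nbr_B:
  assumes "B' \<in> tern_words s" "Q \<in> closed_nbrs B'" "(A, Q, C, 1) \<in> S" "(A, B', C, 1) \<in> S"
  shows "walk_le E3C_E S 1 (A, Q, C, 1) (A, B', C, 1)"
proof (cases "Q = B'")
  case True
  then show ?thesis using assms(4) by (simp add: walk_le.refl)
next
  case False
  then have "differ_one Q B'" using assms(1,2) differ_one_sym by (auto simp: in_closed_nbrs_iff)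
  then show ?thesis using assms(3,4) by (intro walk_le_edge E3C_E_B)
qed

locale E3C_ends =
  fixes r s t :: nat and X Y Z X' Y' Z' :: "nat list"
  assumes X_word: "X \<in> tern_words r" and Y_word: "Y \<in> tern_words s" and Z_word: "Z \<in> tern_words t"
    and X'_word: "X' \<in> tern_words r" and Y'_word: "Y' \<in> tern_words s" and Z'_word: "Z' \<in> tern_words t"
    and pos: "1 \<le> r" "1 \<le> s" "1 \<le> t"
begin

lemmas words = X_word Y_word Z_word X'_word Y'_word Z'_word

abbreviation "V \<equiv> E3C_V r s t"
abbreviation "u \<equiv> (X, Y, Z, 2::nat)"
abbreviation "routing_to v n U \<equiv> routing E3C_E V u v (r + s + t + 5) n U"

text \<open>In the products below, a vertex in layer 2, 1, 0 may change its first, second, third word. The word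
  \<open>Z1\<close> is to differ from \<open>Z\<close> and \<open>Z'\<close>, so the middle part lies in slices that no other route visits.\<close>
definition detour :: "nat list \<Rightarrow> nat list \<Rightarrow> e3c_vertex set" where
  "detour A Z1 = {X} \<times> {Y} \<times> tern_words t \<times> {0} \<union> tern_words r \<times> {Y} \<times> {Z1} \<times> {2}
     \<union> {A} \<times> tern_words s \<times> {Z1} \<times> {1} \<union> {A} \<times> {Y'} \<times> tern_words t \<times> {0}"

lemma route_detour:
  assumes A: "A \<in> tern_words r" and Z1: "Z1 \<in> detour_words t Z Z'" and d: "d \<in> {1, 2}"
  shows "route E3C_E V u (A, Y', Z', d) (hamming X A + s + t + 5) (detour A Z1)"
proof -
  have Z1_word: "Z1 \<in> tern_words t" "Z1 \<noteq> Z" "Z1 \<noteq> Z'"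
    and Z1_near: "hamming Z Z1 + hamming Z1 Z' \<le> Suc t"
    using Z1 by (auto simp: detour_words_def)
  let ?v = "(A, Y', Z', d)"
  let ?S = "insert ?v (detour A Z1)"
  have "walk_le E3C_E ?S (hamming Z Z1) (X, Y, Z, 0) (X, Y, Z1, 0)"
    by (rule walk_le_C[OF Z_word Z1_word(1)]) (auto simp: detour_def)
  also have "walk_le E3C_E ?S 1 (X, Y, Z1, 0) (X, Y, Z1, 2)"
    by (rule walk_le_layer) (use words Z1_word in \<open>auto simp: detour_def\<close>)
  also have "walk_le E3C_E ?S (hamming X A) (X, Y, Z1, 2) (A, Y, Z1, 2)"
    by (rule walk_le_A[OF X_word A]) (auto simp: detour_def)
  also have "walk_le E3C_E ?S 1 (A, Y, Z1, 2) (A, Y, Z1, 1)"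
    by (rule walk_le_layer) (use words A Z1_word in \<open>auto simp: detour_def\<close>)
  also have "walk_le E3C_E ?S (hamming Y Y') (A, Y, Z1, 1) (A, Y', Z1, 1)"
    by (rule walk_le_B[OF Y_word Y'_word]) (auto simp: detour_def)
  also have "walk_le E3C_E ?S 1 (A, Y', Z1, 1) (A, Y', Z1, 0)"
    by (rule walk_le_layer) (use words Z1_word in \<open>auto simp: detour_def\<close>)
  also have "walk_le E3C_E ?S (hamming Z1 Z') (A, Y', Z1, 0) (A, Y', Z', 0)"
    by (rule walk_le_C[OF Z1_word(1) Z'_word]) (auto simp: detour_def)
  also have "walk_le E3C_E ?S 1 (A, Y', Z', 0) ?v"
    by (rule walk_le_layer) (use words d in \<open>auto simp: detour_def\<close>)
  finally have "walk_le E3C_E ?S (hamming X A + s + t + 5) (X, Y, Z, 0) ?v"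
    by (rule walk_le_mono) (use Z1_near hamming_tern_words_le[OF Y_word, of Y'] in auto)
  moreover have "detour A Z1 \<subseteq> V - {u, ?v}"
    using words A Z1_word d by (auto simp: detour_def)
  moreover have "(X, Y, Z, 0) \<in> detour A Z1" "E3C_E u (X, Y, Z, 0)"
    using words by (auto simp: detour_def E3C_E_layer)
  ultimately show ?thesis unfolding route_def by blast
qed

lemma route_via_layer_1:
  assumes "P \<in> closed_nbrs X" and "S \<subseteq> V - {u, v}"
    and "if P = X then (P, Y, Z, 1) \<in> S else (P, Y, Z, 2) \<in> S"
    and walk: "walk_le E3C_E (insert v S) k (P, Y, Z, 1) v"
  shows "route E3C_E V u v (Suc k) S"
proof (cases "P = X")
  case True
  moreover have "walk_le E3C_E (insert v S) (Suc k) (P, Y, Z, 1) v"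
    using walk by (rule walk_le_mono) auto
  ultimately show ?thesis
    unfolding route_def using assms(2,3) E3C_E_layer[of 2 1] by fastforce
next
  case False
  then have "E3C_E u (P, Y, Z, 2)"
    using assms(1) words by (auto simp: in_closed_nbrs_iff intro: E3C_E_A)
  moreover have "walk_le E3C_E (insert v S) (Suc k) (P, Y, Z, 2) v"
    using walk_le.step[OF _ E3C_E_layer walk, of 2] False assms(3) by simp
  ultimately show ?thesis
    unfolding route_def using False assms(2,3) by auto
qed

definition sweep :: "nat list \<Rightarrow> nat list \<Rightarrow> e3c_vertex set" where
  "sweep P Q = {P} \<times> tern_words s \<times> {Z} \<times> {1} \<union> {P} \<times> {Q} \<times> tern_words t \<times> {0}"

lemma walk_le_sweep:
  assumes "Q \<in> tern_words s" "sweep P Q \<subseteq> S" "(P, Q, Z', 2) \<in> S"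
  shows "walk_le E3C_E S (s + t + 2) (P, Y, Z, 1) (P, Q, Z', 2)"
proof -
  have "walk_le E3C_E S (hamming Y Q) (P, Y, Z, 1) (P, Q, Z, 1)"
    by (rule walk_le_B[OF Y_word assms(1)]) (use assms(2) in \<open>auto simp: sweep_def\<close>)
  also have "walk_le E3C_E S 1 (P, Q, Z, 1) (P, Q, Z, 0)"
    by (rule walk_le_layer) (use words assms in \<open>auto simp: sweep_def\<close>)
  also have "walk_le E3C_E S (hamming Z Z') (P, Q, Z, 0) (P, Q, Z', 0)"
    by (rule walk_le_C[OF Z_word Z'_word]) (use assms(2) in \<open>auto simp: sweep_def\<close>)
  also have "walk_le E3C_E S 1 (P, Q, Z', 0) (P, Q, Z', 2)"
    by (rule walk_le_layer) (use words assms in \<open>auto simp: sweep_def\<close>)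
  finally show ?thesis
    by (rule walk_le_mono)
      (use hamming_tern_words_le[OF Y_word, of Q] hamming_tern_words_le[OF Z_word, of Z'] in auto)
qed

end

section \<open>Both ends in layer 2\<close>

context E3C_ends
begin

abbreviation "v2 \<equiv> (X', Y', Z', 2::nat)"

definition codetour :: "nat list \<Rightarrow> e3c_vertex set" where
  "codetour Y1 = {X} \<times> tern_words s \<times> {Z} \<times> {1} \<union> tern_words r \<times> {Y1} \<times> {Z} \<times> {2}
     \<union> {X'} \<times> {Y1} \<times> tern_words t \<times> {0} \<union> {X'} \<times> tern_words s \<times> {Z'} \<times> {1}"

lemma route_codetour:
  assumes Y1: "Y1 \<in> detour_words s Y Y'"
  shows "route E3C_E V u v2 (hamming X X' + s + t + 5) (codetour Y1)"
proof -
  interpret swapped: E3C_ends r t s X Z Y X' Z' Y'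
    using words pos by unfold_locales
  have "codetour Y1 = swap01 ` swapped.detour X' Y1"
    unfolding codetour_def swapped.detour_def swap01_def
    by (auto simp: image_Un image_iff)
  moreover have "route E3C_E V (swap01 (X, Z, Y, 2)) (swap01 (X', Z', Y', 2)) (hamming X X' + t + s + 5)
      (swap01 ` swapped.detour X' Y1)"
    by (rule route_map[where f = swap01, OF swapped.route_detour[OF X'_word Y1]])
      (auto simp: inj_swap01 swap01_image_V swap01_E)
  ultimately show ?thesis by (simp add: swap01_def transpose_def add_ac)
qed

text \<open>Replaces \<open>detour X'\<close> when \<open>X\<close> and \<open>X'\<close> are adjacent: then the lane through \<open>X'\<close> already ends
  in the neighbour \<open>(X', Y', Z', 0)\<close> of the target, and \<open>(X, Y', Z', 2)\<close> is free.\<close>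
definition bypass :: "nat list \<Rightarrow> e3c_vertex set" where
  "bypass Z1 = insert (X, Y', Z', 2) (detour X Z1)"

lemma route_bypass:
  assumes Z1: "Z1 \<in> detour_words t Z Z'" and "differ_one X X'" "Z \<noteq> Z'"
  shows "route E3C_E V u v2 (s + t + 6) (bypass Z1)"
proof -
  have "route E3C_E V u (X, Y', Z', 2) (s + t + 5) (detour X Z1)"
    using route_detour[OF X_word Z1, of 2] by simp
  then have "route E3C_E V u v2 (Suc (s + t + 5)) (bypass Z1)"
    unfolding bypass_def using assms words
    by (intro route_snoc) (auto simp: detour_def detour_words_def E3C_E_A)
  then show ?thesis by (rule route_mono) simp
qed

definition fan_lane :: "nat list \<Rightarrow> e3c_vertex set" where
  "fan_lane P = {(P, Y, Z, 2)} \<union> sweep P Y' \<union> fan X X' P \<times> {Y'} \<times> {Z'} \<times> {2}"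

lemma length_X: "length X = length X'"
  using words by (simp add: tern_words_length)

lemma route_fan_lane:
  assumes P: "P \<in> tern_nbrs X" and ne: "(P, Y, Z, 2) \<noteq> v2"
  shows "route E3C_E V u v2 (r + s + t + 5) (fan_lane P)"
proof -
  have P_nbr: "P \<in> tern_words r" "differ_one X P" "P \<noteq> X"
    using P X_word by (auto simp: in_tern_nbrs_iff)
  let ?S = "insert v2 (fan_lane P)"
  have "walk_le E3C_E ?S (s + t + 2) (P, Y, Z, 1) (P, Y', Z', 2)"
    using start_in_fan[OF length_X P_nbr(2)] by (intro walk_le_sweep Y'_word) (auto simp: fan_lane_def)
  also have "walk_le E3C_E ?S (length X) (P, Y', Z', 2) v2"
    by (rule walk_le_map[where f = "\<lambda>W. (W, Y', Z', 2)", OF walk_le_fan[OF length_X P_nbr(2)]])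
      (auto simp: fan_lane_def E3C_E_A)
  finally have "walk_le E3C_E ?S (r + s + t + 2) (P, Y, Z, 1) v2"
    by (rule walk_le_mono) (use words in \<open>simp_all add: tern_words_length\<close>)
  moreover have "fan_lane P \<subseteq> V - {u, v2}"
    using words P_nbr ne fan_avoids_ends[OF length_X P_nbr(2)] fan_subset_tern_words[OF X_word X'_word P]
    by (auto simp: fan_lane_def sweep_def)
  moreover have "P \<in> closed_nbrs X" using P by (simp add: closed_nbrs_def)
  moreover have "if P = X then (P, Y, Z, 1) \<in> fan_lane P else (P, Y, Z, 2) \<in> fan_lane P"
    using P_nbr(3) by (simp add: fan_lane_def)
  ultimately have "route E3C_E V u v2 (Suc (r + s + t + 2)) (fan_lane P)"
    by (intro route_via_layer_1)
  then show ?thesis by (rule route_mono) simp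
qed

lemma fan_lane_disjoint:
  assumes "P \<in> tern_nbrs X" "Q \<in> tern_nbrs X" "P \<noteq> Q"
    "(P, Y, Z, 2) \<noteq> v2" "(Q, Y, Z, 2) \<noteq> v2"
  shows "fan_lane P \<inter> fan_lane Q = {}"
proof -
  have nbrs: "differ_one X P" "differ_one X Q" using assms(1,2) X_word by (auto simp: in_tern_nbrs_iff)
  then show ?thesis
    using fan_disjoint[OF length_X nbrs assms(3)] start_in_fan[OF length_X nbrs(1)]
      start_in_fan[OF length_X nbrs(2)] assms(3-5)
    unfolding fan_lane_def sweep_def by auto
qed

lemma routing_fan_lanes:
  assumes "N \<subseteq> tern_nbrs X" "\<And>P. P \<in> N \<Longrightarrow> (P, Y, Z, 2) \<noteq> v2"
  shows "routing_to v2 (card N) (\<Union>P\<in>N. fan_lane P)"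
proof (rule routing_family)
  show "finite N" using assms(1) finite_tern_nbrs[OF X_word] finite_subset by blast
  show "route E3C_E V u v2 (r + s + t + 5) (fan_lane P)" if "P \<in> N" for P
    using that assms by (intro route_fan_lane) auto
  show "disjoint_family_on fan_lane N"
    unfolding disjoint_family_on_def using assms by (intro ballI impI fan_lane_disjoint) auto
qed

lemma X_notin_fan: "P \<in> tern_nbrs X \<Longrightarrow> X \<notin> fan X X' P"
  using fan_avoids_ends(1)[OF length_X] by (simp add: in_tern_nbrs_iff[OF X_word])

lemma routing_codetour:
  assumes "N \<subseteq> tern_nbrs X" and ne: "\<And>P. P \<in> N \<Longrightarrow> P \<noteq> X' \<or> Z \<noteq> Z'"
    and Y1: "Y1 \<in> detour_words s Y Y'"
  shows "routing_to v2 (Suc (card N)) ((\<Union>P\<in>N. fan_lane P) \<union> codetour Y1)"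
proof (rule routing_insert[OF routing_fan_lanes])
  show "route E3C_E V u v2 (r + s + t + 5) (codetour Y1)"
    by (rule route_mono[OF route_codetour[OF Y1]]) (simp add: hamming_tern_words_le X_word)
  show "codetour Y1 \<inter> (\<Union>P\<in>N. fan_lane P) = {}"
    using ne assms(1) Y1 by (fastforce simp: detour_words_def codetour_def fan_lane_def sweep_def dest: tern_nbr_neq)
qed (use assms in auto)

lemma routing_codetour_detour:
  assumes "N \<subseteq> tern_nbrs X" "X' \<notin> N"
    and Y1: "Y1 \<in> detour_words s Y Y'" and Z1: "Z1 \<in> detour_words t Z Z'"
  shows "routing_to v2 (card N + 2) ((\<Union>P\<in>N. fan_lane P) \<union> codetour Y1 \<union> detour X' Z1)"
proof -
  have "route E3C_E V u v2 (r + s + t + 5) (detour X' Z1)"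
    by (rule route_mono[OF route_detour[OF X'_word Z1]]) (simp_all add: hamming_tern_words_le X_word)
  moreover have "detour X' Z1 \<inter> ((\<Union>P\<in>N. fan_lane P) \<union> codetour Y1) = {}"
    using assms by (fastforce simp: detour_words_def detour_def codetour_def fan_lane_def sweep_def dest: tern_nbr_neq)
  moreover have "routing_to v2 (Suc (card N)) ((\<Union>P\<in>N. fan_lane P) \<union> codetour Y1)"
    by (rule routing_codetour[OF assms(1) _ Y1]) (use assms(2) in auto)
  ultimately show ?thesis using routing_insert by fastforce
qed

lemma routing_codetour_bypass:
  assumes "differ_one X X'" "Z \<noteq> Z'"
    and Y1: "Y1 \<in> detour_words s Y Y'" and Z1: "Z1 \<in> detour_words t Z Z'"
  shows "routing_to v2 (2 * r + 2) ((\<Union>P\<in>tern_nbrs X. fan_lane P) \<union> codetour Y1 \<union> bypass Z1)"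
proof -
  have "X \<noteq> X'" using assms(1) by auto
  have "route E3C_E V u v2 (r + s + t + 5) (bypass Z1)"
    by (rule route_mono[OF route_bypass[OF Z1 assms(1,2)]]) (use pos in simp)
  moreover have "bypass Z1 \<inter> ((\<Union>P\<in>tern_nbrs X. fan_lane P) \<union> codetour Y1) = {}"
    using assms \<open>X \<noteq> X'\<close>
    by (fastforce simp: detour_words_def bypass_def detour_def codetour_def fan_lane_def sweep_def
        dest: tern_nbr_neq X_notin_fan)
  moreover have "routing_to v2 (Suc (2 * r)) ((\<Union>P\<in>tern_nbrs X. fan_lane P) \<union> codetour Y1)"
    using routing_codetour[OF order_refl _ Y1] assms(2) card_tern_nbrs[OF X_word] by simp
  ultimately show ?thesis using routing_insert by fastforce
qed

lemma linkable_layer_2: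
  assumes ne: "u \<noteq> v2" and adj: "differ_one X X' \<Longrightarrow> Z \<noteq> Z' \<or> (Y = Y' \<and> Z = Z')"
  shows "linkable V E3C_E (2 * r + 2) (r + s + t + 6) u v2"
proof -
  obtain Y1 where Y1: "Y1 \<in> detour_words s Y Y'"
    using ex_detour_word[OF Y_word Y'_word pos(2)] by metis
  obtain Z1 where Z1: "Z1 \<in> detour_words t Z Z'"
    using ex_detour_word[OF Z_word Z'_word pos(3)] by metis
  have ends: "u \<in> V" "v2 \<in> V" using words by auto
  note card = card_tern_nbrs[OF X_word]
  consider (bypass) "differ_one X X'" "Z \<noteq> Z'" | (adjacent) "differ_one X X'" "Y = Y'" "Z = Z'"
    | (nonadjacent) "\<not> differ_one X X'"
    using adj by blast
  then show ?thesis
  proof cases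
    case bypass
    from routing_imp_linkable[OF routing_codetour_bypass[OF bypass Y1 Z1] ends ne] show ?thesis
      by (simp add: eval_nat_numeral)
  next
    case adjacent
    define N where "N = tern_nbrs X - {X'}"
    have "X' \<in> tern_nbrs X" using adjacent words by (simp add: in_tern_nbrs_iff)
    then have "Suc (card N) = 2 * r"
      unfolding N_def card[symmetric] by (rule card_Suc_Diff1[OF finite_tern_nbrs[OF X_word]])
    moreover have "E3C_E u v2" using adjacent E3C_E_A by simp
    with routing_codetour_detour[OF _ _ Y1 Z1, of N]
    have "linkable V E3C_E (Suc (card N + 2)) (r + s + t + 6) u v2"
      using routing_imp_linkable_adjacent[OF _ ends ne] by (fastforce simp: N_def eval_nat_numeral)
    ultimately show ?thesis by simp
  next
    case nonadjacent
    then have "X' \<notin> tern_nbrs X" by (simp add: in_tern_nbrs_iff[OF X_word])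
    from routing_imp_linkable[OF routing_codetour_detour[OF order_refl this Y1 Z1] ends ne] show ?thesis
      by (simp add: card eval_nat_numeral)
  qed
qed

end

section \<open>Ends in layers 2 and 1\<close>

context E3C_ends
begin

abbreviation "v1 \<equiv> (X', Y', Z', 1::nat)"

text \<open>\<open>P\<close> and \<open>Q\<close> are neighbours of \<open>X\<close> and \<open>Y'\<close>, but \<open>P = X\<close> and \<open>Q = Y'\<close> are allowed too and stand
  for a layer change at the end in question; then the end itself has to be removed from the set.\<close>
definition matched_lane :: "nat list \<Rightarrow> nat list \<Rightarrow> e3c_vertex set" where
  "matched_lane P Q = ({(P, Y, Z, 2)} \<union> sweep P Q \<union> tern_words r \<times> {Q} \<times> {Z'} \<times> {2}
     \<union> {(X', Q, Z', 1)}) - {u, v1}"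

lemma route_matched_lane:
  assumes P: "P \<in> closed_nbrs X" and Q: "Q \<in> closed_nbrs Y'" and ne: "Z \<noteq> Z' \<or> P \<noteq> X' \<and> Q \<noteq> Y"
  shows "route E3C_E V u v1 (r + s + t + 5) (matched_lane P Q)"
proof -
  have P_word: "P \<in> tern_words r" and Q_word: "Q \<in> tern_words s"
    using P Q closed_nbrs_subset words by auto
  let ?S = "insert v1 (matched_lane P Q)"
  have "walk_le E3C_E ?S (s + t + 2) (P, Y, Z, 1) (P, Q, Z', 2)"
    using P_word ne by (intro walk_le_sweep Q_word) (auto simp: matched_lane_def sweep_def)
  also have "walk_le E3C_E ?S (hamming P X') (P, Q, Z', 2) (X', Q, Z', 2)"
    by (rule walk_le_A[OF P_word X'_word]) (use ne in \<open>auto simp: matched_lane_def\<close>)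
  also have "walk_le E3C_E ?S 1 (X', Q, Z', 2) (X', Q, Z', 1)"
    by (rule walk_le_layer) (use words ne in \<open>auto simp: matched_lane_def\<close>)
  also have "walk_le E3C_E ?S 1 (X', Q, Z', 1) v1"
    by (rule walk_le_closed_nbr_B[OF Y'_word Q]) (auto simp: matched_lane_def)
  finally have "walk_le E3C_E ?S (r + s + t + 4) (P, Y, Z, 1) v1"
    by (rule walk_le_mono) (use hamming_tern_words_le[OF P_word, of X'] in auto)
  moreover have "matched_lane P Q \<subseteq> V - {u, v1}"
    using words P_word Q_word by (auto simp: matched_lane_def sweep_def)
  moreover have "if P = X then (P, Y, Z, 1) \<in> matched_lane P Q else (P, Y, Z, 2) \<in> matched_lane P Q"
    using words ne by (auto simp: matched_lane_def sweep_def)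
  ultimately have "route E3C_E V u v1 (Suc (r + s + t + 4)) (matched_lane P Q)"
    using P by (intro route_via_layer_1)
  then show ?thesis by (rule route_mono) simp
qed

lemma matched_lane_disjoint:
  assumes "P \<noteq> P'" "Q \<noteq> Q'" and "Z \<noteq> Z' \<or> P \<noteq> X' \<and> Q \<noteq> Y \<and> P' \<noteq> X' \<and> Q' \<noteq> Y"
  shows "matched_lane P Q \<inter> matched_lane P' Q' = {}"
  using assms unfolding matched_lane_def sweep_def by auto

lemma matched_lane_detour_disjoint:
  assumes "Z1 \<in> detour_words t Z Z'" "(P, Q) \<noteq> (X, Y)" "(P, Q) \<noteq> (X', Y')"
  shows "matched_lane P Q \<inter> detour X' Z1 = {}"
  using assms unfolding matched_lane_def sweep_def detour_def detour_words_def by auto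

lemma routing_matched_lanes:
  assumes M: "is_matching (closed_nbrs X) (closed_nbrs Y') M"
    and free: "Z \<noteq> Z' \<and> (X, Y) \<notin> M \<and> (X', Y') \<notin> M \<or> (\<forall>(P, Q)\<in>M. P \<noteq> X' \<and> Q \<noteq> Y)"
    and Z1: "Z1 \<in> detour_words t Z Z'"
  shows "routing_to v1 (Suc (card M)) ((\<Union>(P, Q)\<in>M. matched_lane P Q) \<union> detour X' Z1)"
proof (rule routing_insert)
  have M_nbrs: "P \<in> closed_nbrs X" "Q \<in> closed_nbrs Y'" if "(P, Q) \<in> M" for P Q
    using M that by (auto simp: is_matching_def)
  have apart: "Z \<noteq> Z' \<or> P \<noteq> X' \<and> Q \<noteq> Y" if "(P, Q) \<in> M" for P Q
    using free that by auto
  show "routing_to v1 (card M) (\<Union>(P, Q)\<in>M. matched_lane P Q)"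
  proof (rule routing_family)
    show "finite M" using M by (simp add: is_matching_def)
    show "route E3C_E V u v1 (r + s + t + 5) (case m of (P, Q) \<Rightarrow> matched_lane P Q)" if "m \<in> M" for m
    proof (cases m)
      case (Pair P Q)
      then show ?thesis using that M_nbrs[of P Q] apart[of P Q] route_matched_lane[of P Q] by simp
    qed
    show "disjoint_family_on (\<lambda>(P, Q). matched_lane P Q) M"
      unfolding disjoint_family_on_def
    proof (intro ballI impI)
      fix m m' assume "m \<in> M" "m' \<in> M" "m \<noteq> m'"
      moreover obtain P Q P' Q' where pairs: "m = (P, Q)" "m' = (P', Q')" by fastforce
      ultimately have "P \<noteq> P'" "Q \<noteq> Q'" "(P, Q) \<in> M" "(P', Q') \<in> M"
        using is_matching_fst_unique[OF M] is_matching_snd_unique[OF M] by blast+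
      then show "(case m of (P, Q) \<Rightarrow> matched_lane P Q) \<inter> (case m' of (P, Q) \<Rightarrow> matched_lane P Q) = {}"
        using matched_lane_disjoint[of P P' Q Q'] apart[of P Q] apart[of P' Q'] by (auto simp: pairs)
    qed
  qed
  show "route E3C_E V u v1 (r + s + t + 5) (detour X' Z1)"
    by (rule route_mono[OF route_detour[OF X'_word Z1]]) (simp_all add: hamming_tern_words_le X_word)
  have "(P, Q) \<noteq> (X, Y)" "(P, Q) \<noteq> (X', Y')" if "(P, Q) \<in> M" for P Q
    using free that by auto
  then show "detour X' Z1 \<inter> (\<Union>(P, Q)\<in>M. matched_lane P Q) = {}"
    using matched_lane_detour_disjoint[OF Z1] by fast
qed

definition direct_lane :: "nat list \<Rightarrow> e3c_vertex set" where
  "direct_lane Q = ({(X', Y, Z, 2)} \<union> {X'} \<times> word_box Y Q \<times> {Z} \<times> {1}) - {u, v1}"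

lemma route_direct_lane:
  assumes "Z = Z'" and X': "X' \<in> closed_nbrs X" and Q: "Q \<in> closed_nbrs Y'" and ne: "(X, Y) \<noteq> (X', Y')"
  shows "route E3C_E V u v1 (r + s + t + 5) (direct_lane Q)"
proof -
  have Q_word: "Q \<in> tern_words s" using Q closed_nbrs_subset words by blast
  then have length_Q: "length Y = length Q" using words by (simp add: tern_words_length)
  let ?S = "insert v1 (direct_lane Q)"
  have "walk_le E3C_E ?S (hamming Y Q) (X', Y, Z, 1) (X', Q, Z, 1)"
    by (rule walk_le_map[where f = "\<lambda>B. (X', B, Z, 1)", OF walk_le_word_box[OF length_Q]])
      (use E3C_E_B in \<open>auto simp: direct_lane_def\<close>)
  also have "walk_le E3C_E ?S 1 (X', Q, Z, 1) (X', Y', Z, 1)"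
    unfolding direct_lane_def using \<open>Z = Z'\<close> word_box_ends(2)[OF length_Q]
    by (intro walk_le_closed_nbr_B[OF Y'_word Q]) auto
  also have "(X', Y', Z, 1) = v1" using \<open>Z = Z'\<close> by simp
  finally have "walk_le E3C_E ?S (r + s + t + 4) (X', Y, Z, 1) v1"
    by (rule walk_le_mono) (use hamming_tern_words_le[OF Y_word, of Q] in auto)
  moreover have "direct_lane Q \<subseteq> V - {u, v1}"
    using words word_box_subset_tern_words[OF Y_word Q_word] by (auto simp: direct_lane_def)
  moreover have "if X' = X then (X', Y, Z, 1) \<in> direct_lane Q else (X', Y, Z, 2) \<in> direct_lane Q"
    unfolding direct_lane_def using ne word_box_ends(1)[of Y Q] by auto
  ultimately have "route E3C_E V u v1 (Suc (r + s + t + 4)) (direct_lane Q)"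
    using X' by (intro route_via_layer_1)
  then show ?thesis by (rule route_mono) simp
qed

lemma ends_21: "u \<in> V" "v1 \<in> V" "u \<noteq> v1"
  using words by auto

lemma linkable_layers_21_far:
  assumes m: "1 \<le> m" "m \<le> r" "m \<le> s"
    and far: "Z \<noteq> Z' \<or> X' \<notin> closed_nbrs X \<and> Y \<notin> closed_nbrs Y'"
  shows "linkable V E3C_E (2 * m + 2) (r + s + t + 6) u v1"
proof -
  obtain Z1 where Z1: "Z1 \<in> detour_words t Z Z'"
    using ex_detour_word[OF Z_word Z'_word pos(3)] .
  have "Suc (2 * m) \<le> card (closed_nbrs X)" "Suc (2 * m) \<le> card (closed_nbrs Y')"
    using m words card_closed_nbrs by auto
  moreover have "X \<in> closed_nbrs X" "Y' \<in> closed_nbrs Y'" by (simp_all add: closed_nbrs_def)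
  ultimately obtain M where M: "is_matching (closed_nbrs X) (closed_nbrs Y') M" "card M = Suc (2 * m)"
      "(X, Y) \<notin> M" "(X', Y') \<notin> M"
    using ex_matching_avoiding[of "closed_nbrs X" "closed_nbrs Y'" "2 * m" X Y' Y X']
      finite_closed_nbrs words m(1) by auto
  have "Z \<noteq> Z' \<and> (X, Y) \<notin> M \<and> (X', Y') \<notin> M \<or> (\<forall>(P, Q)\<in>M. P \<noteq> X' \<and> Q \<noteq> Y)"
    using far M unfolding is_matching_def by blast
  from routing_imp_linkable[OF routing_matched_lanes[OF M(1) this Z1] ends_21] show ?thesis
    by (simp add: M(2) eval_nat_numeral)
qed

lemma linkable_layers_21_near:
  assumes m: "m \<le> r" "m \<le> s" and Z_eq: "Z = Z'" and X': "X' \<in> closed_nbrs X"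
  shows "linkable V E3C_E (2 * m + 2) (r + s + t + 6) u v1"
proof -
  obtain Z1 where Z1: "Z1 \<in> detour_words t Z Z'"
    using ex_detour_word[OF Z_word Z'_word pos(3)] .
  obtain Q where Q: "Q \<in> closed_nbrs Y'" "word_box Y Q \<inter> closed_nbrs Y' = {Q}"
    using ex_last_nbr[OF Y_word Y'_word] .
  have "\<exists>M. is_matching (closed_nbrs X - {X'}) (closed_nbrs Y' - {Q}) M \<and> card M = 2 * m"
    by (rule ex_matching)
      (use m X' Q(1) words in \<open>auto simp: finite_closed_nbrs card_closed_nbrs\<close>)
  then obtain M where M: "is_matching (closed_nbrs X - {X'}) (closed_nbrs Y' - {Q}) M" "card M = 2 * m"
    by blast
  have avoid: "P \<noteq> X'" "R \<notin> word_box Y Q" if "(P, R) \<in> M" for P R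
    using M(1) that Q(2) unfolding is_matching_def by blast+
  have "is_matching (closed_nbrs X) (closed_nbrs Y') M"
    using M(1) unfolding is_matching_def by blast
  moreover have "\<forall>(P, R)\<in>M. P \<noteq> X' \<and> R \<noteq> Y"
    using avoid word_box_ends(1)[of Y Q] by blast
  ultimately have lanes: "routing_to v1 (Suc (2 * m)) ((\<Union>(P, R)\<in>M. matched_lane P R) \<union> detour X' Z1)"
    using routing_matched_lanes[OF _ _ Z1, of M] M(2) by simp
  show ?thesis
  proof (cases "(X, Y) = (X', Y')")
    case True
    then have "E3C_E u v1" using Z_eq by (simp add: E3C_E_layer)
    from routing_imp_linkable_adjacent[OF lanes ends_21 this] show ?thesis
      by (simp add: eval_nat_numeral)
  next
    case False
    have "direct_lane Q \<inter> ((\<Union>(P, R)\<in>M. matched_lane P R) \<union> detour X' Z1) = {}"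
      using avoid Z1 word_box_ends(1)[of Y Q]
      unfolding direct_lane_def matched_lane_def sweep_def detour_def detour_words_def by auto
    from routing_insert[OF lanes route_direct_lane[OF Z_eq X' Q(1) False] this] show ?thesis
      using routing_imp_linkable[OF _ ends_21] by (fastforce simp: eval_nat_numeral)
  qed
qed

end

section \<open>The upper bound\<close>

definition layers_linkable :: "nat \<Rightarrow> nat \<Rightarrow> nat \<Rightarrow> bool" where
  "layers_linkable m d d' \<longleftrightarrow> (\<forall>r s t A B C A' B' C'.
     m \<le> r \<longrightarrow> m \<le> s \<longrightarrow> m \<le> t \<longrightarrow>
     (A, B, C, d) \<in> E3C_V r s t \<longrightarrow> (A', B', C', d') \<in> E3C_V r s t \<longrightarrow>
     (A, B, C, d) \<noteq> (A', B', C', d') \<longrightarrow>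
     linkable (E3C_V r s t) E3C_E (2 * m + 2) (r + s + t + 6) (A, B, C, d) (A', B', C', d'))"

lemma layers_linkable_sym: "layers_linkable m d d' \<Longrightarrow> layers_linkable m d' d"
  unfolding layers_linkable_def by (metis E3C_E_sym linkable_rev)

lemma layers_linkable_swap12:
  assumes "layers_linkable m d d'"
  shows "layers_linkable m (transpose 1 2 d) (transpose 1 2 d')"
  unfolding layers_linkable_def
proof (intro allI impI)
  fix r s t A B C A' B' C'
  assume "m \<le> r" "m \<le> s" "m \<le> t" "(A, B, C, transpose 1 2 d) \<in> E3C_V r s t"
    "(A', B', C', transpose 1 2 d') \<in> E3C_V r s t"
    "(A, B, C, transpose 1 2 d) \<noteq> (A', B', C', transpose 1 2 d')"
  then have "linkable (E3C_V s r t) E3C_E (2 * m + 2) (s + r + t + 6) (B, A, C, d) (B', A', C', d')"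
    using assms unfolding layers_linkable_def by (auto simp: transpose_def split: if_splits)
  from linkable_swap12[OF this]
  show "linkable (E3C_V r s t) E3C_E (2 * m + 2) (r + s + t + 6)
      (A, B, C, transpose 1 2 d) (A', B', C', transpose 1 2 d')"
    by (simp add: swap12_def add_ac)
qed

lemma layers_linkable_swap01:
  assumes "layers_linkable m d d'"
  shows "layers_linkable m (transpose 0 1 d) (transpose 0 1 d')"
  unfolding layers_linkable_def
proof (intro allI impI)
  fix r s t A B C A' B' C'
  assume "m \<le> r" "m \<le> s" "m \<le> t" "(A, B, C, transpose 0 1 d) \<in> E3C_V r s t"
    "(A', B', C', transpose 0 1 d') \<in> E3C_V r s t"
    "(A, B, C, transpose 0 1 d) \<noteq> (A', B', C', transpose 0 1 d')"
  then have "linkable (E3C_V r t s) E3C_E (2 * m + 2) (r + t + s + 6) (A, C, B, d) (A', C', B', d')"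
    using assms unfolding layers_linkable_def by (auto simp: transpose_def split: if_splits)
  from linkable_swap01[OF this]
  show "linkable (E3C_V r s t) E3C_E (2 * m + 2) (r + s + t + 6)
      (A, B, C, transpose 0 1 d) (A', B', C', transpose 0 1 d')"
    by (simp add: swap01_def add_ac)
qed

lemma layers_linkable_22:
  assumes "1 \<le> m"
  shows "layers_linkable m 2 2"
  unfolding layers_linkable_def
proof (intro allI impI)
  fix r s t A B C A' B' C'
  assume bounds: "m \<le> r" "m \<le> s" "m \<le> t"
    and ends: "(A, B, C, 2) \<in> E3C_V r s t" "(A', B', C', 2) \<in> E3C_V r s t"
    and ne: "(A, B, C, 2) \<noteq> (A', B', C', 2::nat)"
  interpret E3C_ends r s t A B C A' B' C'
    using assms bounds ends by unfold_locales auto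
  interpret swapped: E3C_ends r t s A C B A' C' B'
    using assms bounds ends by unfold_locales auto
  have "linkable (E3C_V r s t) E3C_E (2 * r + 2) (r + s + t + 6) (A, B, C, 2) (A', B', C', 2)"
  proof (cases "C \<noteq> C' \<or> B = B'")
    case True
    then show ?thesis using ne by (intro linkable_layer_2) auto
  next
    case False
    then have "linkable (E3C_V r t s) E3C_E (2 * r + 2) (r + t + s + 6) (A, C, B, 2) (A', C', B', 2)"
      using ne by (intro swapped.linkable_layer_2) auto
    from linkable_swap01[OF this] show ?thesis
      by (simp add: swap01_def transpose_def add_ac)
  qed
  then show "linkable (E3C_V r s t) E3C_E (2 * m + 2) (r + s + t + 6) (A, B, C, 2) (A', B', C', 2)"
    using bounds by (auto intro: linkable_mono)
qed

lemma layers_linkable_21: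
  assumes "1 \<le> m"
  shows "layers_linkable m 2 1"
  unfolding layers_linkable_def
proof (intro allI impI)
  fix r s t A B C A' B' C'
  assume bounds: "m \<le> r" "m \<le> s" "m \<le> t"
    and ends: "(A, B, C, 2) \<in> E3C_V r s t" "(A', B', C', 1) \<in> E3C_V r s t"
  interpret E3C_ends r s t A B C A' B' C'
    using assms bounds ends by unfold_locales auto
  interpret reversed: E3C_ends s r t B' A' C' B A C
    using assms bounds ends by unfold_locales auto
  consider (far) "C \<noteq> C' \<or> A' \<notin> closed_nbrs A \<and> B \<notin> closed_nbrs B'"
    | (near) "C = C'" "A' \<in> closed_nbrs A"
    | (near_reversed) "C = C'" "B \<in> closed_nbrs B'"
    by blast
  then show "linkable (E3C_V r s t) E3C_E (2 * m + 2) (r + s + t + 6) (A, B, C, 2) (A', B', C', 1)"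
  proof cases
    case far
    then show ?thesis using assms bounds by (intro linkable_layers_21_far)
  next
    case near
    then show ?thesis using bounds by (intro linkable_layers_21_near)
  next
    case near_reversed
    then have "linkable (E3C_V s r t) E3C_E (2 * m + 2) (s + r + t + 6) (B', A', C', 2) (B, A, C, 1)"
      using bounds by (intro reversed.linkable_layers_21_near) auto
    from linkable_swap12[OF linkable_rev[OF this E3C_E_sym]] show ?thesis
      by (simp add: swap12_def transpose_def add_ac)
  qed
qed

lemma layers_linkable:
  assumes "1 \<le> m" and d: "d \<in> {0, 1, 2}" "d' \<in> {0, 1, 2}"
  shows "layers_linkable m d d'"
proof -
  have "layers_linkable m 2 2" "layers_linkable m 2 1"
    using assms(1) by (rule layers_linkable_22, rule layers_linkable_21)
  moreover from this have "layers_linkable m 1 1" "layers_linkable m 2 0"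
    using layers_linkable_swap12[of m 2 2] layers_linkable_swap01[of m 2 1] by (auto simp: transpose_def)
  moreover from this have "layers_linkable m 0 0" "layers_linkable m 1 0"
    using layers_linkable_swap01[of m 1 1] layers_linkable_swap12[of m 2 0] by (auto simp: transpose_def)
  ultimately show ?thesis
    using d layers_linkable_sym by auto
qed

lemma E3C_wide_diam_le:
  assumes "1 \<le> m" "m \<le> r" "m \<le> s" "m \<le> t"
  shows "wide_diam (E3C_V r s t) E3C_E (2 * m + 2) \<le> enat (r + s + t + 6)"
proof (rule wide_diam_le)
  fix u v assume uv: "u \<in> E3C_V r s t" "v \<in> E3C_V r s t" "u \<noteq> v"
  obtain A B C d A' B' C' d' where "u = (A, B, C, d)" "v = (A', B', C', d')"
    by (cases u, cases v)
  moreover from this uv have "layers_linkable m d d'"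
    using assms(1) by (intro layers_linkable) auto
  ultimately show "linkable (E3C_V r s t) E3C_E (2 * m + 2) (r + s + t + 6) u v"
    using uv assms(2-4) unfolding layers_linkable_def by blast
qed

section \<open>The lower bound\<close>

text \<open>A lower bound for the distance to \<open>(A', B', C', 2)\<close>: the summand that is added to the Hamming
  distances counts the layer changes that are still needed.\<close>
fun potential :: "nat list \<Rightarrow> nat list \<Rightarrow> nat list \<Rightarrow> e3c_vertex \<Rightarrow> nat" where
  "potential A' B' C' (A, B, C, d) = hamming A A' + hamming B B' + hamming C C' +
     (if d = 2 then (if B = B' \<and> C = C' then 0 else if B = B' \<or> C = C' then 2 else 3)
      else if d = 1 then (if C = C' then 1 else 2)
      else (if B = B' then 1 else 2))"

lemma potential_le_Suc:
  assumes "x \<in> E3C_V r s t" "y \<in> E3C_V r s t" "E3C_E x y"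
  shows "potential A' B' C' x \<le> potential A' B' C' y + 1"
proof -
  obtain A B C d A1 B1 C1 d1 where xy: "x = (A, B, C, d)" "y = (A1, B1, C1, d1)"
    by (cases x, cases y)
  have d: "d \<in> {0, 1, 2}" "d1 \<in> {0, 1, 2}" using assms xy by auto
  from assms(3) consider (E0) "A = A1" "B = B1" "C = C1" "d \<noteq> d1"
    | (E1) "d = 0" "d1 = 0" "A = A1" "B = B1" "differ_one C C1"
    | (E2) "d = 1" "d1 = 1" "A = A1" "C = C1" "differ_one B B1"
    | (E3) "d = 2" "d1 = 2" "B = B1" "C = C1" "differ_one A A1"
    unfolding E3C_E_def xy by auto
  then show ?thesis
  proof cases
    case E0
    then show ?thesis using d unfolding xy by auto
  next
    case E1
    then show ?thesis using hamming_le_differ_one[of C C1 C'] unfolding xy by auto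
  next
    case E2
    then show ?thesis using hamming_le_differ_one[of B B1 B'] unfolding xy by auto
  next
    case E3
    then show ?thesis using hamming_le_differ_one[of A A1 A'] unfolding xy by auto
  qed
qed

lemma E3C_fault_diam_ge:
  assumes "1 \<le> r" "1 \<le> s" "1 \<le> t"
  shows "enat (r + s + t + 4) \<le> fault_diam (E3C_V r s t) E3C_E (2 * r + 1)"
proof -
  define zeros ones :: "nat \<Rightarrow> nat list"
    where "zeros k = replicate k 0" and "ones k = replicate k 1" for k
  define W where "W = (zeros r)[0 := 2]"
  define u v w where "u = (zeros r, zeros s, zeros t, 2::nat)" and "v = (ones r, ones s, ones t, 2::nat)"
    and "w = (W, zeros s, zeros t, 2::nat)"
  let ?h = "potential (ones r) (ones s) (ones t)"
  have words: "zeros k \<in> tern_words k" "ones k \<in> tern_words k" for k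
    by (auto simp: zeros_def ones_def tern_words_def)
  have zeros_neq_ones: "zeros k \<noteq> ones k" if "1 \<le> k" for k
    using that by (auto simp: zeros_def ones_def)
  have W: "W \<in> tern_words r" "differ_one (zeros r) W"
    using assms words tern_words_update[OF words(1)] by (auto simp: W_def zeros_def intro!: differ_one_update)
  have "hamming W (ones r) = r" "hamming (zeros k) (ones k) = k" for k
    by (subst hamming_eq_length; auto simp: W_def zeros_def ones_def nth_list_update)+
  then have "Suc (?h w - ?h v) = r + s + t + 4"
    using assms zeros_neq_ones by (simp add: w_def v_def)
  moreover have "enat (Suc (?h w - ?h v)) \<le> fault_diam (E3C_V r s t) E3C_E (2 * r + 1)"
  proof (rule fault_diam_ge_potential)
    show "?h x \<le> ?h y + 1" if "x \<in> E3C_V r s t" "y \<in> E3C_V r s t" "E3C_E x y" for x y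
      using potential_le_Suc that .
    show "u \<in> E3C_V r s t" "v \<in> E3C_V r s t" "w \<in> E3C_V r s t"
      using words W by (auto simp: u_def v_def w_def)
    show "u \<noteq> v" "\<not> E3C_E u v"
      using zeros_neq_ones assms by (auto simp: u_def v_def E3C_E_def)
    show "E3C_E u w" using W(2) by (simp add: u_def w_def E3C_E_A)
    show "card {x \<in> E3C_V r s t. E3C_E u x} = Suc (2 * r + 1)"
      using card_E3C_nbrs_layer_2 words by (simp add: u_def)
  qed (rule E3C_E_irrefl)
  ultimately show ?thesis by (simp only:)
qed

theorem theorem3:
  fixes r s t n :: nat
  assumes "1 \<le> r" and "r \<le> s" and "s \<le> t" and "n = r + s + t + 1"
  shows "enat (n + 3) = enat (r + s + t + 4)
       \<and> enat (r + s + t + 4) \<le> fault_diam (E3C_V r s t) E3C_E (2 * r + 1)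
       \<and> fault_diam (E3C_V r s t) E3C_E (2 * r + 1) \<le> wide_diam (E3C_V r s t) E3C_E (2 * r + 2)
       \<and> wide_diam (E3C_V r s t) E3C_E (2 * r + 2) \<le> enat (r + s + t + 6)
       \<and> enat (r + s + t + 6) = enat (n + 5)"
proof -
  have "enat (r + s + t + 4) \<le> fault_diam (E3C_V r s t) E3C_E (2 * r + 1)"
    using assms by (intro E3C_fault_diam_ge) auto
  moreover have "fault_diam (E3C_V r s t) E3C_E (2 * r + 1) \<le> wide_diam (E3C_V r s t) E3C_E (2 * r + 2)"
    using fault_diam_le_wide_diam[of "E3C_V r s t" E3C_E "2 * r + 1"] by simp
  moreover have "wide_diam (E3C_V r s t) E3C_E (2 * r + 2) \<le> enat (r + s + t + 6)"
    using assms by (intro E3C_wide_diam_le) auto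
  ultimately show ?thesis using assms(4) by auto
qed

end
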